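(* Let $\mathrm{char}(\mathbb F)=p>0$ and $0\neq h\in R=\mathbb F[x]$. The kernel of the restriction map $\mathsf{Res}:\mathrm{Der}_{\mathbb F}(A_h)\to\mathrm{Der}_{\mathbb F}(\mathsf Z(A_h))$ is $$\ker\mathsf{Res}=\mathcal D_\Theta+\{\mathrm{ad}_a\mid a\in\mathsf N_{A_1}(A_h)\},$$ where $\mathcal D_\Theta=\{D_r\mid r\in\Theta\}$ and $\Theta=\big\{r\in R\mid \delta^{p-1}(r)=\tfrac{\delta^p(x)}{h}\,r\big\}$.
   Context: $\mathbb F$ is a field of characteristic $p>0$, $R=\mathbb F[x]$, $0\ne h\in R$. The Weyl algebra $A_1$ is the unital associative $\mathbb F$-algebra with generators $x,y$ and relation $yx-xy=1$. $A_h$ is the unital associative $\mathbb F$-algebra with generators $x,\hat y$ and relation $\hat yx-x\hat y=h$; it is identified with the subalgebra of $A_1$ generated by $x$ and $\hat y=yh$. $\mathsf Z(A_h)$ is the center of $A_h$ (it equals $\mathbb F[x^p,h^py^p]$). $\mathsf{Res}$ sends a derivation of $A_h$ to its restriction to $\mathsf Z(A_h)$. With $\mathrm{ad}_u(v)=[u,v]=uv-vu$, $\mathsf N_{A_1}(A_h)=\{u\in A_1\mid[u,A_h]\subseteq A_h\}$; for $u$ in it, $\mathrm{ad}_u$ is regarded as a derivation of $A_h$. For $r\in R$, $D_r$ is the derivation of $A_h$ with $D_r(x)=0$, $D_r(\hat y)=r$. $\delta:R\to R$ is the derivation $\delta(f)=f'h$, where $f'$ is the usual derivative; $\delta^p(x)$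 is divisible by $h$ in $R$. *)

theory Defs
  imports
    "HOL-Library.Poly_Mapping"
    "HOL-Library.FuncSet"
    "HOL-Computational_Algebra.Polynomial"
begin

section \<open>The free algebra on two generators\<close>

datatype gen = GX | GY

text \<open>
  Words in the two letters, as an additively written monoid (\<open>+\<close> is concatenation), so that the
  convolution product of \<^theory>\<open>HOL-Library.Poly_Mapping\<close> is the product of the monoid algebra,
  i.e. of the free unital associative algebra on \<^const>\<open>GX\<close> and \<^const>\<open>GY\<close>.
\<close>

datatype word = Word (letters: "gen list")

instantiation word :: monoid_add
begin

definition "0 = Word []"
definition "v + w = Word (letters v @ letters w)"

instance by standard (simp_all add: zero_word_def plus_word_def)

end

type_synonym 'a free_alg = "word \<Rightarrow>\<^sub>0 'a"

abbreviation freeX :: "'a::field free_alg" where "freeX \<equiv> Poly_Mapping.single (Word [GX]) 1"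
abbreviation freeY :: "'a::field free_alg" where "freeY \<equiv> Poly_Mapping.single (Word [GY]) 1"

lemma free_alg_induct [case_names zero single add]:
  fixes P :: "'a::field free_alg \<Rightarrow> bool"
  assumes "P 0" "\<And>w c. P (Poly_Mapping.single w c)" "\<And>a b. P a \<Longrightarrow> P b \<Longrightarrow> P (a + b)"
  shows "P a"
proof (induction a rule: update_induct)
  case const
  show ?case by (rule assms(1))
next
  case (update f w c)
  have "Poly_Mapping.update w c f = f + Poly_Mapping.single w c"
    using update by (intro poly_mapping_eqI)
      (auto simp: lookup_update lookup_add lookup_single in_keys_iff)
  then show ?case using update assms by simp
qed

section \<open>The Weyl algebra\<close>

definition two_sided_ideal :: "'r::ring_1 set \<Rightarrow> bool" where
  "two_sided_ideal I \<longleftrightarrow>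
     0 \<in> I \<and> (\<forall>a\<in>I. \<forall>b\<in>I. a + b \<in> I) \<and> (\<forall>a\<in>I. \<forall>r. r * a \<in> I \<and> a * r \<in> I)"

definition weyl_ideal :: "'a::field free_alg set" where
  "weyl_ideal = two_sided_ideal hull {freeY * freeX - freeX * freeY - 1}"

lemma two_sided_ideal_weyl_ideal: "two_sided_ideal weyl_ideal"
  unfolding weyl_ideal_def by (rule hull_in) (auto simp: two_sided_ideal_def)

lemma weyl_ideal_rules:
  "0 \<in> weyl_ideal"
  "a \<in> weyl_ideal \<Longrightarrow> b \<in> weyl_ideal \<Longrightarrow> a + b \<in> weyl_ideal"
  "a \<in> weyl_ideal \<Longrightarrow> r * a \<in> weyl_ideal"
  "a \<in> weyl_ideal \<Longrightarrow> a * r \<in> weyl_ideal"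
  "a \<in> weyl_ideal \<Longrightarrow> - a \<in> weyl_ideal"
  using two_sided_ideal_weyl_ideal mult_minus1[of a] unfolding two_sided_ideal_def by metis+

definition weyl_rel :: "'a::field free_alg \<Rightarrow> 'a free_alg \<Rightarrow> bool" where
  "weyl_rel a b \<longleftrightarrow> a - b \<in> weyl_ideal"

lemma equivp_weyl_rel: "equivp weyl_rel"
proof (rule equivpI)
  show "reflp weyl_rel" by (simp add: reflp_def weyl_rel_def weyl_ideal_rules(1))
  show "symp weyl_rel"
    unfolding symp_def weyl_rel_def by (metis minus_diff_eq weyl_ideal_rules(5))
  show "transp weyl_rel"
    unfolding transp_def weyl_rel_def by (metis diff_add_cancel add_diff_eq weyl_ideal_rules(2))
qed

text \<open>
  The free algebra acts on \<open>\<F>[x][t]\<close> by letting the first generator act as multiplication by \<open>x\<close>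
  and the second as \<open>\<partial>/\<partial>x + t\<close>; this action factors through the quotient by \<^const>\<open>weyl_ideal\<close>
  (and is faithful on it, in every characteristic).
\<close>

fun act_gen :: "gen \<Rightarrow> 'a::field poly poly \<Rightarrow> 'a poly poly" where
  "act_gen GX g = smult [:0, 1:] g"
| "act_gen GY g = map_poly pderiv g + pCons 0 g"

definition act :: "'a::field free_alg \<Rightarrow> 'a poly poly \<Rightarrow> 'a poly poly" where
  "act a g = (\<Sum>w\<in>Poly_Mapping.keys a. smult [:Poly_Mapping.lookup a w:] (foldr act_gen (letters w) g))"

lemma act_gen_add: "act_gen s (f + g) = act_gen s f + act_gen s g"
  by (cases s) (auto simp: smult_add_right intro!: poly_eqI
      simp: coeff_map_poly pderiv_add coeff_pCons split: nat.splits)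

lemma act_gen_scale: "act_gen s (smult [:c:] g) = smult [:c:] (act_gen s g)"
  by (cases s) (auto intro!: poly_eqI
      simp: coeff_map_poly pderiv_mult pderiv_smult pderiv_pCons coeff_pCons algebra_simps split: nat.splits)

lemma foldr_act_gen_add:
  "foldr act_gen l (f + g) = foldr act_gen l f + foldr act_gen l g"
  by (induction l) (simp_all add: act_gen_add)

lemma foldr_act_gen_scale:
  "foldr act_gen l (smult [:c:] g) = smult [:c:] (foldr act_gen l g)"
  by (induction l) (simp_all add: act_gen_scale)

lemma act_superset:
  assumes "finite S" "Poly_Mapping.keys a \<subseteq> S"
  shows "act a g = (\<Sum>w\<in>S. smult [:Poly_Mapping.lookup a w:] (foldr act_gen (letters w) g))"
  unfolding act_def using assms by (intro sum.mono_neutral_left) (auto simp: in_keys_iff)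

lemma act_0 [simp]: "act 0 g = 0"
  by (simp add: act_def)

lemma act_single: "act (Poly_Mapping.single w c) g = smult [:c:] (foldr act_gen (letters w) g)"
  by (subst act_superset[of "{w}"]) auto

lemma act_add: "act (a + b) g = act a g + act b g"
proof -
  let ?S = "Poly_Mapping.keys a \<union> Poly_Mapping.keys b"
  have "act c g = (\<Sum>w\<in>?S. smult [:Poly_Mapping.lookup c w:] (foldr act_gen (letters w) g))"
    if "Poly_Mapping.keys c \<subseteq> ?S" for c using that by (intro act_superset) auto
  note * = this
  show ?thesis using keys_add[of a b]
    by (simp add: * lookup_add flip: sum.distrib smult_add_left)
qed

lemma act_diff: "act (a - b) g = act a g - act b g"
  using act_add[of "a - b" b g] by simp

lemma act_add_right: "act a (f + g) = act a f + act a g"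
  by (simp add: act_def foldr_act_gen_add smult_add_right sum.distrib)

lemma act_0_right [simp]: "act a 0 = 0"
  by (metis act_add_right add_0 add_cancel_right_right)

lemma act_mult: "act (a * b) g = act a (act b g)"
proof (induction a rule: free_alg_induct)
  case (single v c)
  show ?case
  proof (induction b rule: free_alg_induct)
    case (single w d)
    show ?case
      by (simp add: mult_single act_single plus_word_def foldr_act_gen_scale mult.commute)
  qed (simp_all add: act_add act_add_right distrib_left)
qed (simp_all add: act_add distrib_right)

lemma act_one: "act 1 g = g"
  unfolding single_one[symmetric] act_single by (simp add: zero_word_def flip: one_pCons)

lemma act_weyl_ideal:
  assumes "a \<in> weyl_ideal"
  shows "act a g = 0"
proof -
  let ?I = "{a :: 'a free_alg. \<forall>g. act a g = 0}"
  have "two_sided_ideal ?I"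
    by (simp add: two_sided_ideal_def act_add act_mult)
  moreover have "act (freeY * freeX - freeX * freeY - 1) g = 0" for g :: "'a poly poly"
  proof -
    have "act_gen GY (act_gen GX g) - act_gen GX (act_gen GY g) = g"
      by (intro poly_eqI) (auto simp: coeff_map_poly pderiv_mult pderiv_pCons coeff_pCons
          algebra_simps split: nat.splits)
    then show ?thesis by (simp add: act_diff act_mult act_single act_one flip: one_pCons)
  qed
  ultimately have "weyl_ideal \<subseteq> ?I"
    unfolding weyl_ideal_def by (intro hull_minimal) auto
  with assms show ?thesis by auto
qed

lemma one_notin_weyl_ideal: "1 \<notin> weyl_ideal"
proof
  assume "1 \<in> (weyl_ideal :: 'a free_alg set)"
  from act_weyl_ideal[OF this, of 1] show False
    by (simp add: act_one)
qed

quotient_type (overloaded) 'a weyl = "'a::field free_alg" / weyl_rel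
  by (rule equivp_weyl_rel)

instantiation weyl :: (field) ring_1
begin

lift_definition zero_weyl :: "'a weyl" is 0 .
lift_definition one_weyl :: "'a weyl" is 1 .
lift_definition plus_weyl :: "'a weyl \<Rightarrow> 'a weyl \<Rightarrow> 'a weyl" is "(+)"
  unfolding weyl_rel_def by (metis add_diff_add weyl_ideal_rules(2))
lift_definition uminus_weyl :: "'a weyl \<Rightarrow> 'a weyl" is uminus
  unfolding weyl_rel_def by (metis minus_diff_minus weyl_ideal_rules(5))
lift_definition minus_weyl :: "'a weyl \<Rightarrow> 'a weyl \<Rightarrow> 'a weyl" is "(-)"
proof -
  fix a b c d :: "'a free_alg"
  assume "weyl_rel a b" "weyl_rel c d"
  moreover have "(a - c) - (b - d) = (a - b) + - (c - d)" by simp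
  ultimately show "weyl_rel (a - c) (b - d)"
    unfolding weyl_rel_def by (metis weyl_ideal_rules(2,5))
qed
lift_definition times_weyl :: "'a weyl \<Rightarrow> 'a weyl \<Rightarrow> 'a weyl" is "(*)"
proof -
  fix a b c d :: "'a free_alg"
  assume "weyl_rel a b" "weyl_rel c d"
  moreover have "a * c - b * d = a * (c - d) + (a - b) * d" by (simp add: algebra_simps)
  ultimately show "weyl_rel (a * c) (b * d)"
    unfolding weyl_rel_def by (simp add: weyl_ideal_rules)
qed

lemma weyl_rel_refl: "weyl_rel a a"
  by (simp add: weyl_rel_def weyl_ideal_rules(1))

lemma weyl_eqI: "a = b \<Longrightarrow> weyl_rel a b"
  by (simp add: weyl_rel_refl)

instance
proof
  fix a b c :: "'a weyl"
  show "a + b + c = a + (b + c)" by transfer (rule weyl_eqI, simp add: algebra_simps)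
  show "a + b = b + a" by transfer (rule weyl_eqI, simp add: algebra_simps)
  show "0 + a = a" by transfer (rule weyl_eqI, simp)
  show "- a + a = 0" by transfer (rule weyl_eqI, simp)
  show "a - b = a + - b" by transfer (rule weyl_eqI, simp)
  show "a * b * c = a * (b * c)" by transfer (rule weyl_eqI, simp add: mult.assoc)
  show "1 * a = a" by transfer (rule weyl_eqI, simp)
  show "a * 1 = a" by transfer (rule weyl_eqI, simp)
  show "(a + b) * c = a * c + b * c" by transfer (rule weyl_eqI, simp add: distrib_right)
  show "a * (b + c) = a * b + a * c" by transfer (rule weyl_eqI, simp add: distrib_left)
  show "(0::'a weyl) \<noteq> 1"
  proof (transfer, unfold weyl_rel_def)
    show "(0::'a free_alg) - 1 \<notin> weyl_ideal"
      using one_notin_weyl_ideal weyl_ideal_rules(5) by fastforce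
  qed
qed

end

lift_definition weyl_const :: "'a::field \<Rightarrow> 'a weyl" is "Poly_Mapping.single 0" .
lift_definition weyl_x :: "'a::field weyl" is freeX .
lift_definition weyl_y :: "'a::field weyl" is freeY .

lemma weyl_relation: "weyl_y * weyl_x - weyl_x * weyl_y = 1"
proof (transfer, unfold weyl_rel_def)
  show "freeY * freeX - freeX * freeY - 1 \<in> (weyl_ideal :: 'a free_alg set)"
    unfolding weyl_ideal_def by (rule hull_inc) simp
qed

definition weyl_scale :: "'a::field \<Rightarrow> 'a weyl \<Rightarrow> 'a weyl" where
  "weyl_scale c u = weyl_const c * u"

section \<open>The algebras \<open>A\<^sub>h\<close>\<close>

text \<open>The embedding of \<open>R = \<F>[x]\<close> into the Weyl algebra.\<close>

definition of_R :: "'a::field poly \<Rightarrow> 'a weyl" where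
  "of_R f = (\<Sum>i\<le>degree f. weyl_scale (coeff f i) (weyl_x ^ i))"

definition subalgebra :: "'a::field weyl set \<Rightarrow> bool" where
  "subalgebra S \<longleftrightarrow>
     1 \<in> S \<and> (\<forall>c. \<forall>u\<in>S. weyl_scale c u \<in> S) \<and> (\<forall>u\<in>S. \<forall>v\<in>S. u + v \<in> S \<and> u * v \<in> S)"

text \<open>
  \<open>A\<^sub>h\<close>, the algebra on generators \<open>x\<close>, \<open>yhat\<close> with relation \<open>yhat x - x yhat = h\<close>, is realised as the
  subalgebra of the Weyl algebra generated by \<open>x\<close> and \<open>yhat = y h\<close>.
\<close>

definition yhat :: "'a::field poly \<Rightarrow> 'a weyl" where
  "yhat h = weyl_y * of_R h"

definition Ah :: "'a::field poly \<Rightarrow> 'a weyl set" where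
  "Ah h = subalgebra hull {weyl_x, yhat h}"

definition commutator :: "'r::ring \<Rightarrow> 'r \<Rightarrow> 'r" where
  "commutator u v = u * v - v * u"

definition center :: "'r::ring set \<Rightarrow> 'r set" where
  "center A = {z \<in> A. \<forall>u\<in>A. z * u = u * z}"

definition normalizer :: "'r::ring set \<Rightarrow> 'r set" where
  "normalizer A = {u. \<forall>v\<in>A. commutator u v \<in> A}"

section \<open>Derivations\<close>

text \<open>
  A derivation of a subalgebra \<open>A\<close> is an element of \<open>A \<rightarrow>\<^sub>E A\<close>, i.e. a map on \<open>A\<close> represented by a
  total function with the fixed value \<^const>\<open>undefined\<close> outside \<open>A\<close>; hence equality of functions
  is equality of derivations.
\<close>

definition Der :: "'a::field weyl set \<Rightarrow> ('a weyl \<Rightarrow> 'a weyl) set" where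
  "Der A = {D \<in> A \<rightarrow>\<^sub>E A.
     (\<forall>u\<in>A. \<forall>v\<in>A. D (u + v) = D u + D v) \<and>
     (\<forall>c. \<forall>u\<in>A. D (weyl_scale c u) = weyl_scale c (D u)) \<and>
     (\<forall>u\<in>A. \<forall>v\<in>A. D (u * v) = D u * v + u * D v)}"

definition der_add ::
  "'a::field weyl set \<Rightarrow> ('a weyl \<Rightarrow> 'a weyl) \<Rightarrow> ('a weyl \<Rightarrow> 'a weyl) \<Rightarrow> 'a weyl \<Rightarrow> 'a weyl" where
  "der_add A D E = (\<lambda>u\<in>A. D u + E u)"

definition ad :: "'a::field weyl set \<Rightarrow> 'a weyl \<Rightarrow> 'a weyl \<Rightarrow> 'a weyl" where
  "ad A a = (\<lambda>v\<in>A. commutator a v)"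

definition Res :: "'a::field weyl set \<Rightarrow> ('a weyl \<Rightarrow> 'a weyl) \<Rightarrow> 'a weyl \<Rightarrow> 'a weyl" where
  "Res A D = restrict D (center A)"

definition ker_Res :: "'a::field poly \<Rightarrow> ('a weyl \<Rightarrow> 'a weyl) set" where
  "ker_Res h = {D \<in> Der (Ah h). Res (Ah h) D = (\<lambda>z\<in>center (Ah h). 0)}"

text \<open>
  The description below is definite for \<open>h \<noteq> 0\<close>: existence and uniqueness are lemma \<open>D_der\<close> at the
  end of this theory.
\<close>

definition D_der :: "'a::field poly \<Rightarrow> 'a poly \<Rightarrow> 'a weyl \<Rightarrow> 'a weyl" where
  "D_der h r = (THE D. D \<in> Der (Ah h) \<and> D weyl_x = 0 \<and> D (yhat h) = of_R r)"

definition \<delta> :: "'a::field poly \<Rightarrow> 'a poly \<Rightarrow> 'a poly" where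
  "\<delta> h f = pderiv f * h"

text \<open>For \<open>p > 0\<close> the polynomial \<open>\<delta>\<^sup>p(x)\<close> is divisible by \<open>h\<close>, so the division below is exact.\<close>

definition \<Theta> :: "nat \<Rightarrow> 'a::field poly \<Rightarrow> 'a poly set" where
  "\<Theta> p h = {r. (\<delta> h ^^ (p - 1)) r = ((\<delta> h ^^ p) [:0, 1:] div h) * r}"

definition D_Theta :: "nat \<Rightarrow> 'a::field poly \<Rightarrow> ('a weyl \<Rightarrow> 'a weyl) set" where
  "D_Theta p h = D_der h ` \<Theta> p h"

section \<open>Well-definedness\<close>

lemma dvd_delta_power: "p > 0 \<Longrightarrow> h dvd (\<delta> h ^^ p) f"
  by (cases p) (simp_all add: \<delta>_def)

lemma weyl_const_simps:
  "weyl_const (a + b) = weyl_const a + weyl_const b"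
  "weyl_const (a * b) = weyl_const a * weyl_const b"
  "weyl_const 0 = 0" "weyl_const 1 = 1"
proof -
  show "weyl_const (a + b) = weyl_const a + weyl_const b"
    by transfer (rule weyl_eqI, simp add: single_add)
  show "weyl_const (a * b) = weyl_const a * weyl_const b"
    by transfer (rule weyl_eqI, simp add: mult_single)
  show "weyl_const 0 = 0" by transfer (rule weyl_eqI, simp)
  show "weyl_const 1 = 1" by transfer (rule weyl_eqI, simp)
qed

lemma weyl_const_commute: "weyl_const c * u = u * weyl_const c"
proof (transfer, rule weyl_eqI)
  fix c :: 'a and u :: "'a free_alg"
  show "Poly_Mapping.single 0 c * u = u * Poly_Mapping.single 0 c"
    by (induction u rule: free_alg_induct)
      (simp_all add: mult_single distrib_left distrib_right mult.commute)
qed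

lemma weyl_scale_mult:
  "weyl_scale c u * v = weyl_scale c (u * v)" "u * weyl_scale c v = weyl_scale c (u * v)"
  unfolding weyl_scale_def by (metis mult.assoc weyl_const_commute)+

lemma weyl_scale_add: "weyl_scale c (u + v) = weyl_scale c u + weyl_scale c v"
  by (simp add: weyl_scale_def distrib_left)

lemma weyl_scale_diff: "weyl_scale c (u - v) = weyl_scale c u - weyl_scale c v"
  by (simp add: weyl_scale_def right_diff_distrib)

lemma subalgebraD:
  assumes "subalgebra A"
  shows "1 \<in> A" "u \<in> A \<Longrightarrow> weyl_scale c u \<in> A"
    "u \<in> A \<Longrightarrow> v \<in> A \<Longrightarrow> u + v \<in> A" "u \<in> A \<Longrightarrow> v \<in> A \<Longrightarrow> u * v \<in> A"
  using assms by (auto simp: subalgebra_def)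

lemma subalgebra_diff:
  assumes "subalgebra A" "u \<in> A" "v \<in> A"
  shows "u - v \<in> A"
proof -
  have "weyl_const (-1) + 1 = (0 :: 'a weyl)"
    by (simp add: weyl_const_simps(3) flip: weyl_const_simps(1,4))
  then have "weyl_const (-1) = (- 1 :: 'a weyl)"
    by (simp add: eq_neg_iff_add_eq_0)
  then have "weyl_scale (-1) v = - v"
    by (simp add: weyl_scale_def)
  then show ?thesis using subalgebraD(2)[OF assms(1,3), of "-1"] subalgebraD(3)[OF assms(1,2)]
    by (metis diff_conv_add_uminus)
qed

lemma DerD:
  assumes "D \<in> Der A"
  shows "u \<in> A \<Longrightarrow> D u \<in> A" "u \<notin> A \<Longrightarrow> D u = undefined"
    "u \<in> A \<Longrightarrow> v \<in> A \<Longrightarrow> D (u + v) = D u + D v"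
    "u \<in> A \<Longrightarrow> D (weyl_scale c u) = weyl_scale c (D u)"
    "u \<in> A \<Longrightarrow> v \<in> A \<Longrightarrow> D (u * v) = D u * v + u * D v"
  using assms by (auto simp: Der_def PiE_def extensional_def)

lemma Res_in_Der:
  assumes A: "subalgebra A" and D: "D \<in> Der A"
  shows "Res A D \<in> Der (center A)"
proof -
  note D' = DerD[OF D] and A' = subalgebraD[OF A]
  have cD: "D z \<in> center A" if z: "z \<in> center A" for z
  proof -
    have zA: "z \<in> A" using z by (simp add: center_def)
    have "D z * u = u * D z" if u: "u \<in> A" for u
    proof -
      have "D (z * u) = D (u * z)" "z * D u = D u * z"
        using z u D'(1) by (auto simp: center_def)
      then show ?thesis using D'(5) zA u by (simp add: add.commute)
    qed
    then show ?thesis using zA D'(1) by (simp add: center_def)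
  qed
  have "u + v \<in> center A" "u * v \<in> center A" "weyl_scale c u \<in> center A"
    if "u \<in> center A" "v \<in> center A" for u v c
  proof -
    show "u + v \<in> center A" using that A' by (auto simp: center_def distrib_left distrib_right)
    show "weyl_scale c u \<in> center A" using that A' by (auto simp: center_def weyl_scale_mult)
    have "u * v * w = w * (u * v)" if "w \<in> A" for w
      using \<open>u \<in> center A\<close> \<open>v \<in> center A\<close> that unfolding center_def by (smt (verit) mem_Collect_eq mult.assoc)
    moreover have "u * v \<in> A" using that unfolding center_def by (blast intro: A'(4))
    ultimately show "u * v \<in> center A" unfolding center_def by blast
  qed
  moreover have "u \<in> A" if "u \<in> center A" for u using that by (simp add: center_def)
  ultimately show ?thesis using cD D' unfolding Der_def Res_def by auto
qed

lemma ad_in_Der: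
  assumes A: "subalgebra A" and a: "a \<in> normalizer A"
  shows "ad A a \<in> Der A"
proof -
  have "commutator a v \<in> A" if "v \<in> A" for v using a that by (simp add: normalizer_def)
  then show ?thesis using subalgebraD[OF A]
    by (auto simp: Der_def ad_def commutator_def weyl_scale_mult weyl_scale_diff algebra_simps)
qed

lemma der_add_in_Der:
  assumes A: "subalgebra A" and D: "D \<in> Der A" and E: "E \<in> Der A"
  shows "der_add A D E \<in> Der A"
  using subalgebraD[OF A] DerD[OF D] DerD[OF E]
  by (auto simp: Der_def der_add_def weyl_scale_add algebra_simps)

lemma subalgebra_Ah: "subalgebra (Ah h)"
  unfolding Ah_def by (rule hull_in) (auto simp: subalgebra_def)

lemma Ah_generators: "weyl_x \<in> Ah h" "yhat h \<in> Ah h"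
  unfolding Ah_def by (auto intro: hull_inc)

lemma Ah_induct [consumes 1, case_names x yhat one scale add mult]:
  assumes "u \<in> Ah h" "P weyl_x" "P (yhat h)" "P 1"
    "\<And>c u. u \<in> Ah h \<Longrightarrow> P u \<Longrightarrow> P (weyl_scale c u)"
    "\<And>u v. u \<in> Ah h \<Longrightarrow> v \<in> Ah h \<Longrightarrow> P u \<Longrightarrow> P v \<Longrightarrow> P (u + v)"
    "\<And>u v. u \<in> Ah h \<Longrightarrow> v \<in> Ah h \<Longrightarrow> P u \<Longrightarrow> P v \<Longrightarrow> P (u * v)"
  shows "P u"
proof -
  have "subalgebra {u \<in> Ah h. P u}"
    using assms subalgebraD[OF subalgebra_Ah[of h]] by (auto simp: subalgebra_def)
  then have "Ah h \<subseteq> {u \<in> Ah h. P u}"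
    using assms(2,3) Ah_generators[of h] by (subst Ah_def, intro hull_minimal) auto
  then show ?thesis using assms(1) by auto
qed

lemma Der_one:
  assumes "D \<in> Der A" "subalgebra A"
  shows "D 1 = 0"
  using DerD(5)[OF assms(1), of 1 1] subalgebraD(1)[OF assms(2)] by simp

lemma Der_Ah_eqI:
  assumes D: "D \<in> Der (Ah h)" and E: "E \<in> Der (Ah h)"
    and "D weyl_x = E weyl_x" "D (yhat h) = E (yhat h)"
  shows "D = E"
proof
  fix u
  show "D u = E u"
  proof (cases "u \<in> Ah h")
    case True
    then show ?thesis
      by (induction rule: Ah_induct)
        (simp_all add: assms DerD[OF D] DerD[OF E] Der_one[OF D subalgebra_Ah] Der_one[OF E subalgebra_Ah])
  next
    case False
    then show ?thesis by (simp add: DerD[OF D] DerD[OF E])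
  qed
qed

lemma of_R_superset:
  assumes "degree f \<le> n"
  shows "of_R f = (\<Sum>i\<le>n. weyl_scale (coeff f i) (weyl_x ^ i))"
  unfolding of_R_def using assms
  by (intro sum.mono_neutral_left) (auto simp: weyl_scale_def coeff_eq_0 weyl_const_simps)

lemma of_R_0 [simp]: "of_R 0 = 0"
  by (simp add: of_R_def weyl_scale_def weyl_const_simps)

lemma of_R_pCons: "of_R (pCons a f) = weyl_const a + weyl_x * of_R f"
proof -
  have "of_R (pCons a f) = (\<Sum>i\<le>Suc (degree f). weyl_scale (coeff (pCons a f) i) (weyl_x ^ i))"
    by (rule of_R_superset) (simp add: degree_pCons_le)
  also have "\<dots> = weyl_const a + (\<Sum>i\<le>degree f. weyl_scale (coeff f i) (weyl_x ^ Suc i))"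
    by (subst sum.atMost_Suc_shift) (simp add: weyl_scale_def)
  also have "\<dots> = weyl_const a + weyl_x * of_R f"
    by (simp add: of_R_def sum_distrib_left weyl_scale_mult)
  finally show ?thesis .
qed

lemma of_R_add: "of_R (f + g) = of_R f + of_R g"
proof (induction f g rule: poly_induct2)
  case (pCons a f b g)
  then show ?case by (simp add: of_R_pCons weyl_const_simps algebra_simps)
qed simp

lemma of_R_smult: "of_R (smult c f) = weyl_const c * of_R f"
proof (induction f)
  case (pCons a f)
  have "weyl_const c * (weyl_x * of_R f) = weyl_x * (weyl_const c * of_R f)"
    by (metis mult.assoc weyl_const_commute)
  with pCons show ?case by (simp add: of_R_pCons weyl_const_simps distrib_left)
qed simp

lemma of_R_mult: "of_R (f * g) = of_R f * of_R g"
proof (induction f)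
  case (pCons a f)
  then show ?case
    by (simp add: of_R_pCons of_R_add of_R_smult weyl_const_simps distrib_right mult.assoc)
qed simp

lemma weyl_y_of_R: "weyl_y * of_R f = of_R f * weyl_y + of_R (pderiv f)"
proof (induction f)
  case (pCons a f)
  have yx: "weyl_y * weyl_x = weyl_x * weyl_y + (1 :: 'a weyl)"
    using weyl_relation[where 'a='a] by (simp add: algebra_simps)
  have "weyl_y * (weyl_x * of_R f) = weyl_x * (weyl_y * of_R f) + of_R f"
    by (simp add: yx distrib_right flip: mult.assoc)
  with pCons show ?case
    by (simp add: of_R_pCons of_R_add pderiv_pCons weyl_const_simps weyl_const_commute[of _ weyl_y] algebra_simps)
qed simp

lemma yhat_of_R: "yhat h * of_R f = of_R f * yhat h + of_R (\<delta> h f)"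
proof -
  have "yhat h * of_R f = weyl_y * of_R f * of_R h"
    by (simp add: yhat_def mult.assoc mult.commute[of h f] flip: of_R_mult)
  then show ?thesis by (simp add: weyl_y_of_R yhat_def \<delta>_def of_R_mult distrib_right mult.assoc)
qed

lemma of_R_in_Ah: "of_R f \<in> Ah h"
proof -
  have "weyl_const c \<in> Ah h" for c
    using subalgebraD(2)[OF subalgebra_Ah subalgebraD(1)[OF subalgebra_Ah], of c h]
    by (simp add: weyl_scale_def)
  note const = this
  show ?thesis
  proof (induction f)
    case 0
    show ?case using const[of 0] by (simp add: weyl_const_simps)
  next
    case (pCons a f)
    then show ?case unfolding of_R_pCons
      using const Ah_generators subalgebraD(3,4)[OF subalgebra_Ah] by blast
  qed
qed

lift_definition weyl_act :: "'a::field weyl \<Rightarrow> 'a poly poly \<Rightarrow> 'a poly poly" is act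
  unfolding weyl_rel_def by (metis act_diff act_weyl_ideal eq_iff_diff_eq_0 ext)

lemma weyl_act_simps:
  "weyl_act 0 g = 0" "weyl_act 1 g = g"
  "weyl_act (u + v) g = weyl_act u g + weyl_act v g"
  "weyl_act (u * v) g = weyl_act u (weyl_act v g)"
  "weyl_act (weyl_const c) g = smult [:c:] g"
  "weyl_act weyl_x g = smult [:0, 1:] g"
  "weyl_act weyl_y g = map_poly pderiv g + pCons 0 g"
  by (transfer; simp add: act_one act_add act_mult act_single zero_word_def flip: one_pCons)+

lemma weyl_act_sum: "weyl_act (sum f S) g = (\<Sum>i\<in>S. weyl_act (f i) g)"
  by (induction S rule: infinite_finite_induct) (simp_all add: weyl_act_simps)

lemma weyl_act_of_R: "weyl_act (of_R f) g = smult f g"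
proof (induction f)
  case (pCons a f)
  have "weyl_act (of_R (pCons a f)) g = smult ([:a:] + [:0, 1:] * f) g"
    by (simp only: of_R_pCons weyl_act_simps pCons.IH smult_add_left smult_smult)
  then show ?case by simp
qed (simp add: weyl_act_simps)

text \<open>Left \<open>R\<close>-linear combinations \<open>\<Sum> g\<^sub>i c\<^sub>i\<close>; for \<open>c\<^sub>i = yhat h ^ i\<close> these give the normal form of \<open>A\<^sub>h\<close>.\<close>

definition lcomb :: "(nat \<Rightarrow> 'a::field weyl) \<Rightarrow> 'a poly poly \<Rightarrow> 'a weyl" where
  "lcomb c g = (\<Sum>i\<le>degree g. of_R (coeff g i) * c i)"

lemma lcomb_superset:
  assumes "degree g \<le> n"
  shows "lcomb c g = (\<Sum>i\<le>n. of_R (coeff g i) * c i)"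
  unfolding lcomb_def using assms by (intro sum.mono_neutral_left) (auto simp: coeff_eq_0)

lemma lcomb_pCons: "lcomb c (pCons a g) = of_R a * c 0 + lcomb (\<lambda>i. c (Suc i)) g"
proof -
  have "lcomb c (pCons a g) = (\<Sum>i\<le>Suc (degree g). of_R (coeff (pCons a g) i) * c i)"
    by (rule lcomb_superset) (simp add: degree_pCons_le)
  then show ?thesis by (subst (asm) sum.atMost_Suc_shift) (simp add: lcomb_def)
qed

lemma lcomb_0 [simp]: "lcomb c 0 = 0"
  by (simp add: lcomb_def)

lemma lcomb_add: "lcomb c (f + g) = lcomb c f + lcomb c g"
proof (induction f g arbitrary: c rule: poly_induct2)
  case (pCons a f b g)
  then show ?case by (simp add: lcomb_pCons of_R_add algebra_simps)
qed simp

lemma lcomb_diff: "lcomb c (f - g) = lcomb c f - lcomb c g"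
  using lcomb_add[of c "f - g" g] by simp

lemma lcomb_smult: "lcomb c (smult f g) = of_R f * lcomb c g"
  by (induction g arbitrary: c) (simp_all add: lcomb_pCons of_R_mult distrib_left mult.assoc)

lemma lcomb_add_left: "lcomb (\<lambda>i. c i + d i) g = lcomb c g + lcomb d g"
  by (simp add: lcomb_def distrib_left sum.distrib)

lemma lcomb_of_R_left: "lcomb (\<lambda>i. of_R f * c i) g = of_R f * lcomb c g"
proof -
  have "of_R a * (of_R f * u) = of_R f * (of_R a * u)" for a u
    by (simp add: mult.commute[of a f] flip: of_R_mult mult.assoc)
  then show ?thesis by (simp add: lcomb_def sum_distrib_left)
qed

lemma yhat_lcomb:
  "yhat h * lcomb c g = lcomb c (map_poly (\<delta> h) g) + lcomb (\<lambda>i. yhat h * c i) g"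
proof (induction g arbitrary: c)
  case (pCons a g)
  have "map_poly (\<delta> h) (pCons a g) = pCons (\<delta> h a) (map_poly (\<delta> h) g)"
    by (rule map_poly_pCons) (simp add: \<delta>_def)
  moreover have "yhat h * (of_R a * u) = of_R a * (yhat h * u) + of_R (\<delta> h a) * u" for u
    by (simp add: yhat_of_R distrib_right flip: mult.assoc)
  ultimately show ?case using pCons by (simp add: lcomb_pCons distrib_left algebra_simps)
qed simp

lemma lcomb_in_Ah:
  assumes "\<And>i. c i \<in> Ah h"
  shows "lcomb c g \<in> Ah h"
  using assms
proof (induction g arbitrary: c)
  case 0
  show ?case using of_R_in_Ah[of 0 h] by simp
next
  case (pCons a g)
  then show ?case unfolding lcomb_pCons
    by (intro subalgebraD(3,4)[OF subalgebra_Ah] of_R_in_Ah) auto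
qed

abbreviation "nform h \<equiv> lcomb (\<lambda>i. yhat h ^ i)"

lemma yhat_nform: "yhat h * nform h g = nform h (map_poly (\<delta> h) g + pCons 0 g)"
  by (subst yhat_lcomb) (simp add: lcomb_add lcomb_pCons)

lemma coeff_act_yhat_power:
  "coeff (weyl_act (yhat h ^ n) 1) m = (if m = n then h ^ n else if m > n then 0
     else coeff (weyl_act (yhat h ^ n) 1) m)"
proof (induction n arbitrary: m)
  case 0
  then show ?case by (simp add: weyl_act_simps)
next
  case (Suc n)
  let ?g = "weyl_act (yhat h ^ n) 1"
  have "weyl_act (yhat h ^ Suc n) 1 = map_poly pderiv (smult h ?g) + pCons 0 (smult h ?g)"
    by (simp add: yhat_def weyl_act_simps weyl_act_of_R)
  then have "coeff (weyl_act (yhat h ^ Suc n) 1) k =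
      pderiv (h * coeff ?g k) + h * (case k of 0 \<Rightarrow> 0 | Suc j \<Rightarrow> coeff ?g j)" for k
    by (simp add: coeff_map_poly coeff_pCons split: nat.splits)
  moreover have "coeff ?g k = 0" if "k > n" for k using Suc[of k] that by simp
  moreover have "coeff ?g n = h ^ n" using Suc[of n] by simp
  ultimately show ?case by (auto split: nat.splits)
qed

lemma nform_eq_0:
  assumes h: "h \<noteq> 0" and g: "nform h g = 0"
  shows "g = 0"
proof (rule ccontr)
  assume "g \<noteq> 0"
  let ?n = "degree g"
  let ?P = "\<lambda>i. coeff (weyl_act (yhat h ^ i) 1) ?n"
  have "0 = coeff (weyl_act (nform h g) 1) ?n" by (simp add: g weyl_act_simps)
  also have "\<dots> = (\<Sum>i\<le>?n. coeff g i * ?P i)"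
    by (simp add: lcomb_def weyl_act_sum weyl_act_simps weyl_act_of_R coeff_sum)
  also have "\<dots> = (\<Sum>i\<le>?n. if i = ?n then coeff g i * h ^ i else 0)"
  proof (rule sum.cong)
    fix i assume "i \<in> {..?n}"
    then show "coeff g i * ?P i = (if i = ?n then coeff g i * h ^ i else 0)"
      using coeff_act_yhat_power[of h i ?n] by (auto simp: le_less)
  qed simp
  also have "\<dots> = lead_coeff g * h ^ ?n" by simp
  finally show False using \<open>g \<noteq> 0\<close> h by simp
qed

lemma nform_inj:
  assumes "h \<noteq> 0" "nform h f = nform h g"
  shows "f = g"
  using nform_eq_0[OF assms(1), of "f - g"] assms(2) by (simp add: lcomb_diff)

lemma nform_surj:
  assumes "u \<in> Ah h"
  shows "\<exists>g. u = nform h g"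
proof -
  have "\<forall>g. \<exists>g'. u * nform h g = nform h g'" using assms
  proof (induction rule: Ah_induct)
    case x
    have "weyl_x = of_R [:0, 1:]"
      by (simp add: of_R_pCons weyl_const_simps)
    then show ?case using lcomb_smult by metis
  next
    case yhat
    show ?case using yhat_nform by blast
  next
    case one
    show ?case by auto
  next
    case (scale c u)
    then show ?case
      unfolding weyl_scale_def mult.assoc by (metis lcomb_smult of_R_0 of_R_pCons mult_zero_right add_0_right)
  next
    case (add u v)
    then show ?case by (metis distrib_right lcomb_add)
  next
    case (mult u v)
    then show ?case by (metis mult.assoc)
  qed
  moreover have "nform h 1 = 1"
    by (simp add: one_pCons lcomb_pCons of_R_pCons weyl_const_simps)
  ultimately show ?thesis by (metis mult_1_right)
qed

text \<open>For every \<open>r\<close> there is exactly one derivation as in the definition of \<^const>\<open>D_der\<close>.\<close>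

fun Dpow :: "'a::field poly \<Rightarrow> 'a poly \<Rightarrow> nat \<Rightarrow> 'a weyl" where
  "Dpow h r 0 = 0"
| "Dpow h r (Suc n) = yhat h * Dpow h r n + of_R r * yhat h ^ n"

lemma D_der_ex:
  assumes h: "h \<noteq> 0"
  shows "\<exists>D \<in> Der (Ah h). D weyl_x = 0 \<and> D (yhat h) = of_R r"
proof -
  note A = subalgebraD[OF subalgebra_Ah[of h]]
  define D where "D = (\<lambda>u\<in>Ah h. lcomb (Dpow h r) (THE g. u = nform h g))"
  have yn: "yhat h ^ n \<in> Ah h" for n
    by (induction n) (auto intro: A Ah_generators)
  have nA: "nform h g \<in> Ah h" for g by (rule lcomb_in_Ah) (rule yn)
  have "Dpow h r n \<in> Ah h" for n
  proof (induction n)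
    case 0
    show ?case using of_R_in_Ah[of 0 h] by simp
  qed (auto intro!: A Ah_generators of_R_in_Ah yn)
  then have lA: "lcomb (Dpow h r) g \<in> Ah h" for g by (rule lcomb_in_Ah)
  have "(THE g'. nform h g = nform h g') = g" for g
    by (rule the_equality) (auto dest: nform_inj[OF h])
  then have D: "D (nform h g) = lcomb (Dpow h r) g" for g by (simp add: D_def nA)
  have n1: "nform h 1 = 1"
    by (simp add: one_pCons lcomb_pCons of_R_pCons weyl_const_simps)
  have D1: "D 1 = 0" using D[of 1] n1 by (simp add: one_pCons lcomb_pCons)
  have Dadd: "D (u + v) = D u + D v" if "u \<in> Ah h" "v \<in> Ah h" for u v
    using that[THEN nform_surj] D lcomb_add by metis
  have DR: "D (of_R f * u) = of_R f * D u" if "u \<in> Ah h" for u f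
    using nform_surj[OF that] D lcomb_smult by metis
  have "of_R [:c:] = weyl_const c" for c :: 'a by (simp add: of_R_pCons)
  then have Dscale: "D (weyl_scale c u) = weyl_scale c (D u)" if "u \<in> Ah h" for c u
    unfolding weyl_scale_def using DR[OF that] by metis
  have X: "weyl_x = of_R [:0, 1:]" by (simp add: of_R_pCons weyl_const_simps)
  have Dx: "D (weyl_x * u) = weyl_x * D u" if "u \<in> Ah h" for u
    unfolding X by (rule DR[OF that])
  have Dy: "D (yhat h * u) = yhat h * D u + of_R r * u" if "u \<in> Ah h" for u
  proof -
    from nform_surj[OF that] obtain g where u: "u = nform h g" by blast
    have "D (yhat h * u) = lcomb (Dpow h r) (map_poly (\<delta> h) g + pCons 0 g)"
      by (simp only: u yhat_nform D)
    also have "\<dots> = lcomb (Dpow h r) (map_poly (\<delta> h) g) +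
        (lcomb (\<lambda>i. yhat h * Dpow h r i) g + of_R r * u)"
      by (simp add: u lcomb_add lcomb_pCons lcomb_add_left lcomb_of_R_left)
    also have "\<dots> = yhat h * D u + of_R r * u"
      by (simp only: u D yhat_lcomb add.assoc)
    finally show ?thesis .
  qed
  have gx: "D weyl_x = 0" using Dx[OF A(1)] D1 by simp
  have gy: "D (yhat h) = of_R r" using Dy[OF A(1)] D1 by simp
  have DA: "D u \<in> Ah h" if "u \<in> Ah h" for u
    using nform_surj[OF that] D lA by metis
  have "\<forall>v\<in>Ah h. D (u * v) = D u * v + u * D v" if "u \<in> Ah h" for u
    using that
  proof (induction rule: Ah_induct)
    case x
    show ?case by (simp add: Dx gx)
  next
    case yhat
    show ?case by (simp add: Dy gy add.commute)
  next
    case one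
    show ?case by (simp add: D1)
  next
    case (scale c u)
    then show ?case by (simp add: weyl_scale_mult Dscale A weyl_scale_add)
  next
    case (add u v)
    then show ?case by (simp add: distrib_right Dadd A algebra_simps)
  next
    case (mult u v)
    then show ?case by (simp add: mult.assoc A distrib_left distrib_right add.assoc)
  qed
  then have "D \<in> Der (Ah h)"
    using DA Dadd Dscale unfolding Der_def by (auto simp: D_def)
  then show ?thesis using gx gy by blast
qed

lemma D_der:
  assumes "h \<noteq> 0"
  shows "D_der h r \<in> Der (Ah h)" "D_der h r weyl_x = 0" "D_der h r (yhat h) = of_R r"
proof -
  have "\<exists>!D. D \<in> Der (Ah h) \<and> D weyl_x = 0 \<and> D (yhat h) = of_R r"
    using D_der_ex[OF assms, of r] Der_Ah_eqI[of _ h] by (metis (no_types, lifting))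
  from theI'[OF this]
  show "D_der h r \<in> Der (Ah h)" "D_der h r weyl_x = 0" "D_der h r (yhat h) = of_R r"
    unfolding D_der_def by blast+
qed

end

theory Submission
  imports Defs
begin

text \<open>
  Write an element of the Weyl algebra \<open>A\<^sub>1\<close> as \<open>\<Sum>f\<^sub>i y\<^sup>i\<close> with \<open>f\<^sub>i\<close> in \<open>R\<close> and call the polynomial
  \<open>\<Sum>f\<^sub>i t\<^sup>i\<close> its symbol. On symbols the maps \<open>u \<mapsto> [u, x]\<close> and \<open>u \<mapsto> [y, u]\<close> are \<open>\<partial>/\<partial>t\<close> and
  \<open>\<partial>/\<partial>x\<close>, so finding an element with prescribed commutators is a matter of integrating polynomials.
  In characteristic \<open>p\<close> a polynomial has an antiderivative as soon as its \<open>(p - 1)\<close>-st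
  derivative is \<open>0\<close> (\<open>antiderivative_exists\<close>). Such conditions come from the value of a derivation
  \<open>d\<close> at a \<open>p\<close>-th power, since \<open>d(u\<^sup>p)\<close> is the \<open>(p - 1)\<close>-fold commutator of \<open>u\<close> with \<open>d(u)\<close>
  (\<open>derivation_power_prime\<close>).

  Let \<open>c = \<delta>\<^sup>p(x)/h\<close>. The element \<open>w = yhat\<^sup>p - c yhat\<close> equals \<open>h\<^sup>p y\<^sup>p\<close> (\<open>w_eq\<close>) and is central. If a
  derivation \<open>d\<close> annihilates \<open>x\<close>, then \<open>d(yhat)\<close> has a symbol \<open>\<Sum>b\<^sub>j t\<^sup>j\<close> in which only multiples \<open>j\<close> of
  \<open>p\<close> occur, and \<open>d(w)\<close> has the coefficients \<open>\<delta>^(p - 1)(b\<^sub>j) - c b\<^sub>j\<close>. Thus \<open>\<Theta>\<close> describes exactly the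
  derivations annihilating \<open>x\<close> and \<open>w\<close> (\<open>derivation_w_eq_0_iff\<close>).

  For the inclusion from right to left, the centralizer of \<open>x\<close> in \<open>A\<^sub>h\<close> is \<open>R[w]\<close> and contains the
  centre, so \<open>D\<^sub>r\<close> with \<open>r\<close> in \<open>\<Theta>\<close> vanishes on the centre; and \<open>ad\<^sub>a\<close> does, because the centre of \<open>A\<^sub>h\<close>
  is contained in that of \<open>A\<^sub>1\<close>.

  Conversely let \<open>D\<close> vanish on the centre. From \<open>D(x\<^sup>p) = 0\<close> one obtains \<open>a\<close> in \<open>A\<^sub>1\<close> with
  \<open>[a, x] = D(x)\<close> (\<open>inner_at_x\<close>). The derivation \<open>d = D - ad\<^sub>a\<close> from \<open>A\<^sub>h\<close> to \<open>A\<^sub>1\<close> annihilates \<open>x\<close> and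
  \<open>w\<close>, so all \<open>b\<^sub>j\<close> lie in \<open>\<Theta>\<close>. Moreover \<open>h\<close> divides \<open>b\<^sub>j\<close> for \<open>j > 0\<close> (\<open>h_dvd_coeff_defect\<close>), and for
  \<open>b\<^sub>j = h e\<close> membership in \<open>\<Theta>\<close> means that \<open>e\<close> has an antiderivative (\<open>h_mult_in_ThetaD\<close>). Hence
  \<open>\<Sum>b\<^sub>j y\<^sup>j\<close>, summed over \<open>j > 0\<close>, is \<open>[yhat, a']\<close> for some \<open>a'\<close> commuting with \<open>x\<close>, and
  \<open>D = D\<^sub>r + ad\<^sub>u\<close> with \<open>r = b\<^sub>0\<close> and \<open>u = a - a'\<close>.
\<close>

section \<open>Derivatives of polynomials in prime characteristic\<close>

lemma pderiv_eq_0_iff_coeff: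
  fixes g :: "'b::idom poly"
  shows "pderiv g = 0 \<longleftrightarrow> (\<forall>k. of_nat k * coeff g k = 0)"
proof
  assume "pderiv g = 0"
  then have "of_nat (Suc k) * coeff g (Suc k) = 0" for k
    by (metis coeff_0 coeff_pderiv)
  then show "\<forall>k. of_nat k * coeff g k = 0" by (metis not0_implies_Suc of_nat_0 mult_zero_left)
next
  assume "\<forall>k. of_nat k * coeff g k = 0"
  then show "pderiv g = 0" by (intro poly_eqI) (simp add: coeff_pderiv del: of_nat_Suc)
qed

lemma pochhammer_prime_char:
  assumes p: "prime p" "CHAR('b::idom) = p" and k: "p dvd k"
  shows "pochhammer (of_nat (Suc k)) (p - 1) \<noteq> (0 :: 'b)"
proof -
  have "of_nat (Suc k + i) \<noteq> (0 :: 'b)" if "i < p - 1" for i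
  proof
    assume "of_nat (Suc k + i) = (0 :: 'b)"
    then have "p dvd k + Suc i" using p(2) by (simp add: of_nat_eq_0_iff_char_dvd del: of_nat_Suc of_nat_add)
    then have "p dvd Suc i" using dvd_add_right_iff[OF k] by blast
    with that show False by (auto dest: dvd_imp_le)
  qed
  then show ?thesis by (simp add: pochhammer_prod add.assoc del: of_nat_Suc flip: of_nat_add)
qed

lemma of_nat_inverse_mod_prime:
  assumes "prime p" "CHAR('b::comm_ring_1) = p" "\<not> p dvd n"
  obtains c :: "'b::comm_ring_1" where "of_nat n * c = 1"
proof -
  have "coprime (int n) (int p)"
    using assms by (metis coprime_commute coprime_int_iff prime_imp_coprime)
  then obtain u v where "u * int n + v * int p = 1"
    by (metis bezout_int coprime_imp_gcd_eq_1)
  then have "of_int (u * int n + v * int p) = (1 :: 'b)" by (metis of_int_1)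
  then have "of_nat n * of_int u = (1 :: 'b)"
    using of_nat_CHAR[where 'a = 'b] assms(2) by (simp add: mult.commute)
  then show thesis by (rule that)
qed

text \<open>
  Every monomial \<open>x\<^sup>m\<close> with \<open>m \<noteq> -1\<close> modulo \<open>p\<close> has an antiderivative, and the
  monomials with \<open>m = -1\<close> are exactly those that the \<open>(p - 1)\<close>-st derivative does not kill.
\<close>

lemma antiderivative_exists:
  fixes g :: "'b::idom poly"
  assumes p: "prime p" "CHAR('b) = p" and g: "(pderiv ^^ (p - 1)) g = 0"
  obtains f where "pderiv f = g"
proof -
  have "\<exists>c. of_nat (Suc k) * c = coeff g k" for k
  proof (cases "p dvd Suc k")
    case True
    then obtain m where m: "Suc k = p * m" by auto
    then have "m > 0" by (cases m) auto
    define l where "l = p * (m - 1)"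
    have "k = l + (p - 1)" using m \<open>m > 0\<close> prime_gt_0_nat[OF p(1)]
      by (cases m) (auto simp: l_def)
    moreover have "pochhammer (of_nat (Suc l)) (p - 1) * coeff g (l + (p - 1)) = 0"
      by (metis coeff_higher_pderiv g coeff_0)
    ultimately have "coeff g k = 0"
      using pochhammer_prime_char[OF p, of l] by (simp add: l_def del: of_nat_Suc)
    then show ?thesis by (intro exI[of _ 0]) simp
  next
    case False
    then obtain c :: 'b where "of_nat (Suc k) * c = 1"
      using of_nat_inverse_mod_prime[OF p] by blast
    then have "of_nat (Suc k) * (c * coeff g k) = coeff g k"
      by (metis mult.assoc mult_1_left)
    then show ?thesis by blast
  qed
  then obtain c where c: "\<And>k. of_nat (Suc k) * c k = coeff g k" by metis
  define f where "f = pCons 0 (\<Sum>k\<le>degree g. monom (c k) k)"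
  have "pderiv f = g"
  proof (rule poly_eqI)
    fix k
    have "coeff f (Suc k) = (if k \<le> degree g then c k else 0)"
      by (simp add: f_def coeff_sum if_distrib cong: if_cong)
    then show "coeff (pderiv f) k = coeff g k"
      by (simp add: coeff_pderiv c coeff_eq_0 del: of_nat_Suc)
  qed
  then show thesis by (rule that)
qed

section \<open>Iterated commutators in characteristic \<open>p\<close>\<close>

lemma binomial_expansion_iterated_commutator:
  fixes a b :: "'r::ring_1"
  shows "(commutator a ^^ n) b = (\<Sum>k\<le>n. of_int ((-1) ^ k * int (n choose k)) * (a ^ (n - k) * b * a ^ k))"
proof (induction n)
  case 0
  show ?case by simp
next
  case (Suc n)
  let ?c = "\<lambda>n k. (-1) ^ k * int (n choose k)"
  let ?t = "\<lambda>n k. a ^ (n - k) * b * a ^ k"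
  have comm: "u * (of_int m * v) = of_int m * (u * v)" for m and u v :: 'r
    using mult_of_int_commute[of m u] by (simp add: mult.assoc[symmetric])
  have left: "a * (\<Sum>k\<le>n. of_int (?c n k) * ?t n k) = (\<Sum>k\<le>Suc n. of_int (?c n k) * ?t (Suc n) k)"
    by (simp add: sum_distrib_left comm Suc_diff_le binomial_eq_0 mult.assoc del: of_int_mult)
  have "(\<Sum>k\<le>n. of_int (?c n k) * ?t n k) * a = (\<Sum>k\<le>n. of_int (?c n k) * ?t (Suc n) (Suc k))"
    by (simp add: sum_distrib_right mult.assoc power_commutes)
  then have "(commutator a ^^ Suc n) b =
      of_int (?c n 0) * ?t (Suc n) 0 + (\<Sum>k\<le>n. of_int (?c n (Suc k)) * ?t (Suc n) (Suc k))
      - (\<Sum>k\<le>n. of_int (?c n k) * ?t (Suc n) (Suc k))"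
    using left by (simp only: funpow.simps comp_apply Suc.IH commutator_def sum.atMost_Suc_shift)
  also have "\<dots> = of_int (?c n 0) * ?t (Suc n) 0 +
      (\<Sum>k\<le>n. of_int (?c n (Suc k) - ?c n k) * ?t (Suc n) (Suc k))"
    by (simp only: of_int_diff left_diff_distrib sum_subtractf add_diff_eq)
  also have "\<dots> = (\<Sum>k\<le>Suc n. of_int (?c (Suc n) k) * ?t (Suc n) k)"
  proof -
    have pascal: "?c n (Suc k) - ?c n k = ?c (Suc n) (Suc k)" for k
      by (simp add: algebra_simps)
    show ?thesis unfolding pascal by (subst sum.atMost_Suc_shift) simp
  qed
  finally show ?case .
qed

lemma binomial_prime_minus_1:
  assumes "prime p" "k < p"
  shows "int p dvd (-1) ^ k * int (p - 1 choose k) - 1"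
  using assms(2)
proof (induction k)
  case (Suc k)
  have "p choose Suc k = (p - 1 choose k) + (p - 1 choose Suc k)"
    using prime_gt_0_nat[OF assms(1)] by (cases p) simp_all
  moreover have "p dvd p choose Suc k"
    using Suc assms(1) by (intro dvd_choose_prime) auto
  ultimately have sum: "int p dvd int (p - 1 choose k) + int (p - 1 choose Suc k)"
    by (metis int_dvd_int_iff of_nat_add)
  have step: "int p dvd (- e) * B - 1" if "int p dvd A + B" "int p dvd e * A - 1" for e A B
  proof -
    have "(e * A - 1) - e * (A + B) = (- e) * B - 1" by (simp add: distrib_left)
    then show ?thesis using dvd_diff[OF that(2) dvd_mult[OF that(1), of e]] by (simp only:)
  qed
  have "int p dvd (-1) ^ k * int (p - 1 choose k) - 1"
    by (rule Suc.IH) (rule Suc_lessD[OF Suc.prems])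
  from step[OF sum this] show ?case by (simp only: power_Suc mult_minus1)
qed simp

text \<open>
  Left and right multiplication by \<open>a\<close> are commuting operators \<open>L\<close> and \<open>R\<close>, and
  in characteristic \<open>p\<close> one has \<open>(L - R)^(p - 1) = \<Sum>L^(p - 1 - k) R^k\<close>,
  because the binomial coefficients of \<open>p - 1\<close> are \<open>1\<close> and \<open>-1\<close> in turn modulo \<open>p\<close>.
\<close>

lemma iterated_commutator_prime_minus_1:
  fixes a b :: "'r::ring_1"
  assumes "prime p" "of_nat p = (0 :: 'r)"
  shows "(commutator a ^^ (p - 1)) b = (\<Sum>k<p. a ^ (p - 1 - k) * b * a ^ k)"
proof -
  have "of_int ((-1) ^ k * int (p - 1 choose k)) = (1 :: 'r)" if k: "k < p" for k
  proof -
    obtain m where "(-1) ^ k * int (p - 1 choose k) - 1 = int p * m"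
      using binomial_prime_minus_1[OF assms(1) k] by auto
    then have "(-1) ^ k * int (p - 1 choose k) = int p * m + 1" by simp
    then show ?thesis using assms(2) by (simp only: of_int_add of_int_mult of_int_of_nat_eq) simp
  qed
  moreover have "{..p - 1} = {..<p}" using prime_gt_0_nat[OF assms(1)] by auto
  ultimately show ?thesis by (simp add: binomial_expansion_iterated_commutator del: of_int_mult)
qed

text \<open>
  With \<open>[a, b]\<close> in place of \<open>b\<close> the sum in the previous lemma telescopes.
\<close>

lemma iterated_commutator_prime:
  fixes a b :: "'r::ring_1"
  assumes "prime p" "of_nat p = (0 :: 'r)"
  shows "(commutator a ^^ p) b = commutator (a ^ p) b"
proof -
  have "(commutator a ^^ p) b = (commutator a ^^ (p - 1)) (commutator a b)"
    using prime_gt_0_nat[OF assms(1)] by (cases p) (simp_all add: funpow_swap1)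
  also have "\<dots> = (\<Sum>k<p. a ^ (p - 1 - k) * commutator a b * a ^ k)"
    by (rule iterated_commutator_prime_minus_1[OF assms])
  also have "\<dots> = (\<Sum>k<p. a ^ (p - k) * b * a ^ k - a ^ (p - Suc k) * b * a ^ Suc k)"
  proof (rule sum.cong)
    fix k assume "k \<in> {..<p}"
    then have "p - k = Suc (p - 1 - k)" "p - Suc k = p - 1 - k" by auto
    then show "a ^ (p - 1 - k) * commutator a b * a ^ k =
        a ^ (p - k) * b * a ^ k - a ^ (p - Suc k) * b * a ^ Suc k"
      by (simp only: commutator_def power_Suc2[of a "p - 1 - k"] power_Suc[of a k]
          left_diff_distrib right_diff_distrib mult.assoc)
  qed simp
  also have "\<dots> = commutator (a ^ p) b"
    by (subst sum_lessThan_telescope') (simp add: commutator_def)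
  finally show ?thesis .
qed

section \<open>The Weyl algebra as a space of polynomials in two variables\<close>

lemma yhat_1: "yhat 1 = weyl_y"
  by (simp add: yhat_def of_R_pCons weyl_const_simps one_pCons)

lemma weyl_x_of_R: "weyl_x = of_R [:0, 1:]"
  by (simp add: of_R_pCons weyl_const_simps)

lemma of_R_1 [simp]: "of_R 1 = 1"
  by (simp add: one_pCons of_R_pCons weyl_const_simps)

lemma of_R_commute: "of_R f * of_R g = of_R g * of_R f"
  by (metis of_R_mult mult.commute)

lemma of_R_power: "of_R (f ^ n) = of_R f ^ n"
  by (induction n) (simp_all add: of_R_mult)

lemma weyl_act_add_right: "weyl_act u (f + g) = weyl_act u f + weyl_act u g"
  by transfer (rule act_add_right)

lemma weyl_act_diff_right: "weyl_act u (f - g) = weyl_act u f - weyl_act u g"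
  using weyl_act_add_right[of u "f - g" g] by simp

lemma weyl_act_diff: "weyl_act (u - v) g = weyl_act u g - weyl_act v g"
  using weyl_act_simps(3)[of "u - v" v g] by simp

lemma Ah_1: "Ah 1 = UNIV"
proof -
  have "u \<in> Ah 1" for u :: "'a::field weyl"
  proof (induction u rule: weyl.abs_induct)
    case (1 a)
    note A = subalgebraD[OF subalgebra_Ah[of "1 :: 'a poly"]]
    have one: "abs_weyl (Poly_Mapping.single (Word []) 1) = (1 :: 'a weyl)"
      by (simp add: one_weyl_def flip: zero_word_def)
    have y: "weyl_y \<in> Ah (1 :: 'a poly)"
      using Ah_generators(2)[of "1 :: 'a poly"] by (simp add: yhat_1)
    have word: "abs_weyl (Poly_Mapping.single (Word l) 1) \<in> Ah (1 :: 'a poly)" for l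
    proof (induction l)
      case Nil
      then show ?case using A(1) by (simp add: one)
    next
      case (Cons s l)
      have "Poly_Mapping.single (Word (s # l)) (1 :: 'a) =
          Poly_Mapping.single (Word [s]) 1 * Poly_Mapping.single (Word l) 1"
        by (simp add: mult_single plus_word_def)
      then have "abs_weyl (Poly_Mapping.single (Word (s # l)) (1 :: 'a)) =
          abs_weyl (Poly_Mapping.single (Word [s]) 1) * abs_weyl (Poly_Mapping.single (Word l) 1)"
        by (simp add: times_weyl.abs_eq)
      moreover have "abs_weyl (Poly_Mapping.single (Word [s]) 1) \<in> Ah (1 :: 'a poly)"
        using y Ah_generators(1)[of "1 :: 'a poly"] by (cases s) (simp_all add: weyl_x_def weyl_y_def)
      ultimately show ?case using Cons A(4) by metis
    qed
    show ?case
    proof (induction a rule: free_alg_induct)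
      case zero
      then show ?case using of_R_in_Ah[of 0 "1 :: 'a poly"] by (simp add: zero_weyl_def)
    next
      case (single w c)
      have "Poly_Mapping.single w c = Poly_Mapping.single 0 c * Poly_Mapping.single w (1 :: 'a)"
        by (simp add: mult_single)
      then have "abs_weyl (Poly_Mapping.single w c) = weyl_scale c (abs_weyl (Poly_Mapping.single w 1))"
        by (simp add: weyl_scale_def times_weyl.abs_eq weyl_const.abs_eq)
      then show ?case using A(2) word by (metis word.exhaust)
    next
      case (add a b)
      then show ?case using A(3) by (metis plus_weyl.abs_eq)
    qed
  qed
  then show ?thesis by auto
qed

text \<open>
  The symbol of \<open>\<Sum>f\<^sub>i y\<^sup>i\<close> is \<open>\<Sum>f\<^sub>i t\<^sup>i\<close>, because \<open>y\<close> acts as \<open>\<partial>/\<partial>x + t\<close>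
  and hence \<open>y\<^sup>i\<close> sends \<open>1\<close> to \<open>t\<^sup>i\<close>.
\<close>

definition symb :: "'a::field weyl \<Rightarrow> 'a poly poly" where
  "symb u = weyl_act u 1"

abbreviation of_symb :: "'a::field poly poly \<Rightarrow> 'a weyl" where
  "of_symb \<equiv> lcomb (\<lambda>i. weyl_y ^ i)"

lemma symb_simps:
  "symb 0 = 0" "symb 1 = 1"
  "symb (u + v) = symb u + symb v" "symb (u - v) = symb u - symb v"
  "symb (of_R f * v) = smult f (symb v)" "symb (of_R f) = [:f:]"
  by (simp_all add: symb_def weyl_act_simps weyl_act_diff weyl_act_of_R)

lemma weyl_act_pCons_0: "weyl_act u (pCons 0 g) = pCons 0 (weyl_act u g)"
proof -
  have "u \<in> Ah 1" by (simp add: Ah_1)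
  then show ?thesis
  proof (induction arbitrary: g rule: Ah_induct)
    case yhat
    then show ?case by (simp add: yhat_1 weyl_act_simps map_poly_pCons)
  qed (simp_all add: weyl_act_simps weyl_scale_def)
qed

lemma symb_mult_y: "symb (u * weyl_y) = pCons 0 (symb u)"
  by (simp add: symb_def weyl_act_simps map_poly_1 flip: weyl_act_pCons_0)

lemma symb_mult_y_power: "symb (u * weyl_y ^ n) = monom 1 n * symb u"
proof (induction n arbitrary: u)
  case (Suc n)
  have "u * weyl_y ^ Suc n = (u * weyl_y) * weyl_y ^ n" by (simp add: mult.assoc)
  with Suc show ?case by (simp add: symb_mult_y monom_Suc del: power_Suc)
qed simp

lemma symb_of_symb: "symb (of_symb g) = g"
proof -
  have "symb (of_symb g) = (\<Sum>i\<le>degree g. smult (coeff g i) (monom 1 i))"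
    using symb_mult_y_power[of "1 :: 'a weyl"]
    by (simp add: lcomb_def symb_def weyl_act_sum weyl_act_simps weyl_act_of_R)
  also have "\<dots> = g"
    by (simp add: smult_monom poly_as_sum_of_monoms)
  finally show ?thesis .
qed

lemma of_symb_symb: "of_symb (symb u) = u"
proof -
  obtain g where "u = nform 1 g" using nform_surj[of u 1] by (auto simp: Ah_1)
  then have "u = of_symb g" by (simp add: yhat_1)
  then show ?thesis by (simp add: symb_of_symb)
qed

lemma symb_inj: "symb u = symb v \<longleftrightarrow> u = v"
  by (metis of_symb_symb)

lemma of_R_inj: "of_R f = of_R g \<longleftrightarrow> f = g"
  by (metis pCons_eq_iff symb_simps(6))

lemma symb_commutator_y: "symb (commutator weyl_y u) = map_poly pderiv (symb u)"
proof -
  have "symb (weyl_y * u) = map_poly pderiv (symb u) + pCons 0 (symb u)"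
    by (simp add: symb_def weyl_act_simps)
  then show ?thesis by (simp add: commutator_def symb_simps symb_mult_y)
qed

text \<open>
  More generally, as operators on polynomials, the action of \<open>[u, x]\<close> is the commutator of
  \<open>\<partial>/\<partial>t\<close> with the action of \<open>u\<close>. Both are derivations in \<open>u\<close>, they vanish at \<open>u = x\<close>,
  and they are the identity at \<open>u = y\<close>.
\<close>

lemma symb_commutator_x: "symb (commutator u weyl_x) = pderiv (symb u)"
proof -
  have "u \<in> Ah 1" by (simp add: Ah_1)
  then have "\<forall>g. weyl_act (commutator u weyl_x) g = pderiv (weyl_act u g) - weyl_act u (pderiv g)"
  proof (induction rule: Ah_induct)
    case x
    then show ?case by (simp add: commutator_def weyl_act_simps pderiv_smult)
  next
    case yhat
    have "pderiv (map_poly pderiv g) = map_poly pderiv (pderiv g)" for g :: "'a poly poly"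
      by (rule poly_eqI) (simp add: coeff_pderiv coeff_map_poly pderiv_mult del: of_nat_Suc)
    then show ?case
      by (simp add: yhat_1 commutator_def weyl_relation weyl_act_simps pderiv_add pderiv_pCons)
  next
    case one
    then show ?case by (simp add: commutator_def weyl_act_simps)
  next
    case (scale c u)
    have "commutator (weyl_scale c u) weyl_x = weyl_scale c (commutator u weyl_x)"
      by (simp add: commutator_def weyl_scale_mult weyl_scale_diff)
    with scale show ?case
      by (simp add: weyl_scale_def weyl_act_simps pderiv_smult smult_diff_right)
  next
    case (add u v)
    have "commutator (u + v) weyl_x = commutator u weyl_x + commutator v weyl_x"
      by (simp add: commutator_def algebra_simps)
    with add show ?case by (simp add: weyl_act_simps pderiv_add)
  next
    case (mult u v)
    have "commutator (u * v) weyl_x = u * commutator v weyl_x + commutator u weyl_x * v"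
      by (simp add: commutator_def algebra_simps)
    with mult show ?case
      by (simp add: weyl_act_simps weyl_act_diff_right)
  qed
  then show ?thesis by (simp add: symb_def weyl_act_simps weyl_act_diff_right[of u 0 0, simplified])
qed

lemma symb_iterated_commutator_x:
  fixes u :: "'a::field weyl"
  shows "symb ((commutator weyl_x ^^ n) u) = (-1) ^ n * (pderiv ^^ n) (symb u)"
proof (induction n)
  case (Suc n)
  let ?v = "(commutator weyl_x ^^ n) u"
  have "commutator weyl_x ?v = 0 - commutator ?v weyl_x" by (simp add: commutator_def)
  then have "symb (commutator weyl_x ?v) = - pderiv (symb ?v)"
    by (simp only: symb_simps(1,4) symb_commutator_x) simp
  moreover have "pderiv ((-1) ^ n * g) = (-1) ^ n * pderiv g" for g :: "'a poly poly"
    by (cases "even n") (simp_all add: pderiv_minus)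
  ultimately show ?case by (simp add: Suc)
qed simp

lemma iterated_commutator_y_of_R: "(commutator weyl_y ^^ n) (of_R f) = of_R ((pderiv ^^ n) f)"
  by (induction n) (simp_all add: commutator_def weyl_y_of_R)

lemma commutes_of_R:
  assumes "commutator u weyl_x = 0"
  shows "commutator u (of_R f) = 0"
proof (induction f)
  case (pCons a f)
  have "u * (weyl_x * v) = weyl_x * (u * v)" for v
    using assms by (simp add: commutator_def flip: mult.assoc)
  with pCons show ?case
    by (simp add: of_R_pCons commutator_def distrib_left distrib_right mult.assoc weyl_const_commute)
qed (simp add: commutator_def)

lemma commutes_all:
  assumes "commutator u weyl_x = 0" "commutator u weyl_y = 0"
  shows "u * v = v * u"
proof -
  have "v \<in> Ah 1" by (simp add: Ah_1)
  then show ?thesis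
  proof (induction rule: Ah_induct)
    case (scale c v)
    then show ?case by (simp add: weyl_scale_mult)
  next
    case (add u v)
    then show ?case by (simp add: distrib_left distrib_right)
  next
    case (mult v w)
    then show ?case by (metis mult.assoc)
  qed (use assms in \<open>simp_all add: commutator_def yhat_1\<close>)
qed

section \<open>Derivations with values in the Weyl algebra\<close>

text \<open>
  Correcting a derivation of \<open>A\<^sub>h\<close> by \<open>ad\<^sub>a\<close> with an arbitrary \<open>a\<close> of the Weyl
  algebra leads out of the maps from \<open>A\<^sub>h\<close> to itself, so the values are left unrestricted here.
\<close>

definition derivation_on :: "'a::field weyl set \<Rightarrow> ('a weyl \<Rightarrow> 'a weyl) \<Rightarrow> bool" where
  "derivation_on A d \<longleftrightarrow>
     (\<forall>u\<in>A. \<forall>v\<in>A. d (u + v) = d u + d v \<and> d (u * v) = d u * v + u * d v) \<and>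
     (\<forall>c. \<forall>u\<in>A. d (weyl_scale c u) = weyl_scale c (d u))"

lemma derivation_onD:
  assumes "derivation_on A d"
  shows "u \<in> A \<Longrightarrow> v \<in> A \<Longrightarrow> d (u + v) = d u + d v"
    "u \<in> A \<Longrightarrow> v \<in> A \<Longrightarrow> d (u * v) = d u * v + u * d v"
    "u \<in> A \<Longrightarrow> d (weyl_scale c u) = weyl_scale c (d u)"
  using assms by (auto simp: derivation_on_def)

lemma derivation_on_Der: "D \<in> Der A \<Longrightarrow> derivation_on A D"
  unfolding derivation_on_def using DerD by metis

lemma derivation_on_diff_commutator:
  assumes "derivation_on A d"
  shows "derivation_on A (\<lambda>u. d u - commutator a u)"
  using derivation_onD[OF assms] unfolding derivation_on_def
  by (auto simp: commutator_def algebra_simps weyl_scale_mult weyl_scale_diff weyl_scale_add)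

lemma power_in_Ah: "u \<in> Ah h \<Longrightarrow> u ^ n \<in> Ah h"
  by (induction n) (auto intro: subalgebraD[OF subalgebra_Ah])

context
  fixes h :: "'a::field poly" and d :: "'a weyl \<Rightarrow> 'a weyl"
  assumes d: "derivation_on (Ah h) d"
begin

lemma derivation_one: "d 1 = 0"
  using derivation_onD(2)[OF d, of 1 1] subalgebraD(1)[OF subalgebra_Ah[of h]] by simp

lemma derivation_diff: "u \<in> Ah h \<Longrightarrow> v \<in> Ah h \<Longrightarrow> d (u - v) = d u - d v"
  using derivation_onD(1)[OF d, of "u - v" v] subalgebra_diff[OF subalgebra_Ah[of h]] by simp

lemma derivation_power:
  assumes "u \<in> Ah h"
  shows "d (u ^ n) = (\<Sum>k<n. u ^ (n - 1 - k) * d u * u ^ k)"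
proof (induction n)
  case 0
  show ?case by (simp add: derivation_one)
next
  case (Suc n)
  have "d (u ^ Suc n) = d u * u ^ n + u * d (u ^ n)"
    using derivation_onD(2)[OF d assms power_in_Ah[OF assms]] by simp
  also have "u * d (u ^ n) = (\<Sum>k<n. u ^ (n - k) * d u * u ^ k)"
  proof -
    have "u * (u ^ (n - 1 - k) * d u * u ^ k) = u ^ (n - k) * d u * u ^ k" if "k < n" for k
    proof -
      from that have "n - k = Suc (n - 1 - k)" by auto
      then show ?thesis by (simp only: power_Suc mult.assoc)
    qed
    then show ?thesis by (simp add: Suc.IH sum_distrib_left)
  qed
  finally show ?case by (simp add: add.commute)
qed

lemma derivation_power_prime:
  assumes "u \<in> Ah h" "prime p" "of_nat p = (0 :: 'a weyl)"
  shows "d (u ^ p) = (commutator u ^^ (p - 1)) (d u)"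
  by (simp only: derivation_power[OF assms(1)] iterated_commutator_prime_minus_1[OF assms(2,3)])

lemma derivation_of_R:
  assumes "d weyl_x = 0"
  shows "d (of_R f) = 0"
proof (induction f)
  case 0
  show ?case using derivation_diff[of 1 1] subalgebraD(1)[OF subalgebra_Ah[of h]] by simp
next
  case (pCons a f)
  note A = subalgebraD[OF subalgebra_Ah[of h]]
  have "of_R (pCons a f) = weyl_scale a 1 + weyl_x * of_R f"
    by (simp add: of_R_pCons weyl_scale_def)
  moreover have "d (weyl_scale a 1) = 0"
    using derivation_onD(3)[OF d A(1)] derivation_one by (simp add: weyl_scale_def)
  ultimately show ?case
    using pCons derivation_onD[OF d] A Ah_generators[of h] of_R_in_Ah[of f h] assms by simp
qed

end

section \<open>The central element \<open>h\<^sup>p y\<^sup>p\<close>\<close>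

lemma coeff_symb_yhat_power:
  "coeff (symb (yhat h ^ n)) n = h ^ n"
  "m > n \<Longrightarrow> coeff (symb (yhat h ^ n)) m = 0"
  unfolding symb_def by (subst coeff_act_yhat_power, simp)+

lemma commutator_yhat_of_R: "commutator (yhat h) (of_R f) = of_R (\<delta> h f)"
  by (simp add: commutator_def yhat_of_R)

lemma iterated_commutator_yhat_of_R:
  "(commutator (yhat h) ^^ n) (of_R f) = of_R ((\<delta> h ^^ n) f)"
  by (induction n) (simp_all add: commutator_yhat_of_R)

lemma pderiv_map_poly_pderiv:
  fixes g :: "'a::field poly poly"
  shows "pderiv (map_poly pderiv g) = map_poly pderiv (pderiv g)"
  by (rule poly_eqI) (simp add: coeff_pderiv coeff_map_poly pderiv_mult del: of_nat_Suc)

text \<open>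
  If \<open>b\<close> commutes with \<open>x\<close>, then so does \<open>[y, b]\<close>, because \<open>\<partial>/\<partial>t\<close> and \<open>\<partial>/\<partial>x\<close> commute on
  symbols; hence \<open>[y h, b] = [y, b] h = h [y, b]\<close>.
\<close>

lemma commutator_yhat_centralizer:
  assumes "commutator b weyl_x = 0"
  shows "commutator (yhat h) b = of_R h * commutator weyl_y b"
    "commutator (commutator (yhat h) b) weyl_x = 0"
proof -
  let ?e = "commutator weyl_y b"
  have "pderiv (symb b) = 0" using assms by (simp add: symb_simps flip: symb_commutator_x)
  then have "symb (commutator ?e weyl_x) = symb 0"
    by (simp add: symb_commutator_x symb_commutator_y pderiv_map_poly_pderiv symb_simps)
  then have e: "commutator ?e weyl_x = 0" by (simp only: symb_inj)
  have "commutator b (of_R h) = 0" using assms by (rule commutes_of_R)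
  then have "weyl_y * (of_R h * b) = weyl_y * (b * of_R h)" by (simp add: commutator_def)
  then have "commutator (yhat h) b = ?e * of_R h"
    by (simp add: commutator_def yhat_def algebra_simps mult.assoc)
  also have "\<dots> = of_R h * ?e"
    using commutes_of_R[OF e, of h] by (simp add: commutator_def)
  finally show *: "commutator (yhat h) b = of_R h * ?e" .
  have "of_R h * weyl_x = weyl_x * of_R h" by (simp add: weyl_x_of_R of_R_commute)
  then have "commutator (of_R h * ?e) weyl_x = of_R h * commutator ?e weyl_x"
    by (simp add: commutator_def right_diff_distrib mult.assoc[symmetric])
  with e show "commutator (commutator (yhat h) b) weyl_x = 0" by (simp add: *)
qed

lemma symb_commutator_yhat:
  assumes "commutator b weyl_x = 0"
  shows "symb (commutator (yhat h) b) = map_poly (\<delta> h) (symb b)"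
  by (rule poly_eqI) (simp add: commutator_yhat_centralizer[OF assms] symb_simps symb_commutator_y
      coeff_map_poly \<delta>_def mult.commute)

lemma delta_0 [simp]: "\<delta> h 0 = 0"
  by (simp add: \<delta>_def)

lemma delta_power_0 [simp]: "(\<delta> h ^^ n) 0 = 0"
  by (induction n) simp_all

lemma symb_iterated_commutator_yhat:
  assumes "commutator b weyl_x = 0"
  shows "symb ((commutator (yhat h) ^^ n) b) = map_poly (\<delta> h ^^ n) (symb b)"
proof -
  have "symb ((commutator (yhat h) ^^ n) b) = map_poly (\<delta> h ^^ n) (symb b) \<and>
      commutator ((commutator (yhat h) ^^ n) b) weyl_x = 0"
  proof (induction n)
    case (Suc n)
    then show ?case
      by (auto simp: commutator_yhat_centralizer(2) symb_commutator_yhat map_poly_map_poly comp_def)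
  qed (use assms in simp)
  then show ?thesis ..
qed

locale weyl_prime_char =
  fixes h :: "'a::field poly" and p :: nat
  assumes char_p: "CHAR('a) = p" and p_pos: "p > 0" and h_nonzero: "h \<noteq> 0"
begin

lemma prime_p: "prime p"
  using prime_CHAR_semidom[where 'a = 'a] char_p p_pos by simp

lemma char_poly: "CHAR('a poly) = p"
  by (simp add: char_p)

lemma of_nat_poly_eq_0_iff: "of_nat n = (0 :: 'a poly) \<longleftrightarrow> p dvd n"
  by (simp add: of_nat_eq_0_iff_char_dvd char_p)

lemma of_nat_weyl: "of_nat p = (0 :: 'a weyl)"
proof -
  have "of_nat n = (weyl_const (of_nat n) :: 'a weyl)" for n
    by (induction n) (simp_all add: weyl_const_simps)
  moreover have "of_nat p = (0 :: 'a)" using char_p of_nat_CHAR by metis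
  ultimately show ?thesis by (simp add: weyl_const_simps)
qed

definition c :: "'a poly" where
  "c = (\<delta> h ^^ p) [:0, 1:] div h"

text \<open>
  This is \<open>h\<^sup>p y\<^sup>p\<close> (lemma \<open>w_eq\<close>), written so that it visibly lies in \<open>A\<^sub>h\<close> and so that the
  value of a derivation at it can be read off from the value at \<open>yhat\<close>.
\<close>

definition w :: "'a weyl" where
  "w = yhat h ^ p - of_R c * yhat h"

lemma w_in_Ah: "w \<in> Ah h"
  unfolding w_def
  by (intro subalgebra_diff subalgebraD(4)[OF subalgebra_Ah] power_in_Ah subalgebra_Ah of_R_in_Ah Ah_generators)

lemma mem_Theta: "r \<in> \<Theta> p h \<longleftrightarrow> (\<delta> h ^^ (p - 1)) r = c * r"
  by (simp add: \<Theta>_def c_def)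

text \<open>
  \<open>\<delta>\<^sup>p\<close> is a derivation of \<open>R\<close>, since it is the restriction of \<open>ad\<close> of \<open>yhat\<^sup>p\<close>.
\<close>

lemma delta_power_p: "(\<delta> h ^^ p) f = c * \<delta> h f"
proof -
  let ?Y = "yhat h ^ p"
  have Y: "commutator ?Y (of_R f) = of_R ((\<delta> h ^^ p) f)" for f
    by (metis iterated_commutator_prime[OF prime_p of_nat_weyl] iterated_commutator_yhat_of_R)
  have cx: "(\<delta> h ^^ p) [:0, 1:] = c * h"
    unfolding c_def using dvd_delta_power[OF p_pos, of h "[:0, 1:]"] by (simp add: dvd_div_mult_self)
  show ?thesis
  proof (induction f)
    case 0
    show ?case by simp
  next
    case (pCons a f)
    have "commutator ?Y (of_R (pCons a f)) =
        commutator ?Y (of_R [:0, 1:]) * of_R f + weyl_x * commutator ?Y (of_R f)"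
      unfolding of_R_pCons[of a f]
      by (simp add: commutator_def algebra_simps weyl_const_commute[of a ?Y] flip: weyl_x_of_R)
    also have "\<dots> = of_R (c * h * f + [:0, 1:] * (c * \<delta> h f))"
      by (simp only: Y cx pCons.IH of_R_add of_R_mult weyl_x_of_R)
    also have "c * h * f + [:0, 1:] * (c * \<delta> h f) = c * \<delta> h (pCons a f)"
      by (simp add: \<delta>_def pderiv_pCons algebra_simps)
    finally show ?case by (simp only: Y of_R_inj)
  qed
qed

lemma commutator_w_x: "commutator w weyl_x = 0"
proof -
  have "commutator (yhat h ^ p) weyl_x = of_R ((\<delta> h ^^ p) [:0, 1:])"
    by (metis iterated_commutator_prime[OF prime_p of_nat_weyl] iterated_commutator_yhat_of_R weyl_x_of_R)
  moreover have "commutator (of_R c * yhat h) weyl_x = of_R c * commutator (yhat h) weyl_x"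
    using of_R_commute[of c "[:0, 1:]"]
    by (simp add: commutator_def right_diff_distrib mult.assoc flip: weyl_x_of_R)
      (simp flip: mult.assoc)
  moreover have "commutator (yhat h) weyl_x = of_R (\<delta> h [:0, 1:])"
    by (metis commutator_yhat_of_R weyl_x_of_R)
  ultimately show ?thesis
    by (simp add: w_def commutator_def delta_power_p of_R_mult algebra_simps)
qed

lemma coeff_0_symb_yhat_power: "h * coeff (symb (yhat h ^ n)) 0 = (\<delta> h ^^ n) h"
proof (induction n)
  case (Suc n)
  have "coeff (symb (yhat h ^ Suc n)) 0 = pderiv (h * coeff (symb (yhat h ^ n)) 0)"
    by (simp add: symb_def yhat_def weyl_act_simps weyl_act_of_R coeff_map_poly)
  then show ?case by (simp add: Suc \<delta>_def mult.commute)
qed (simp add: symb_simps)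

text \<open>
  Since \<open>w\<close> commutes with \<open>x\<close>, its symbol is a polynomial in \<open>t\<^sup>p\<close>, of degree \<open>p\<close>;
  its constant coefficient \<open>e\<close> satisfies \<open>h e = \<delta>\<^sup>p(h) - c \<delta>(h) = 0\<close>.
\<close>

lemma symb_w: "symb w = monom (h ^ p) p"
proof (rule poly_eqI)
  fix m
  have p2: "p \<ge> 2" using prime_p by (rule prime_ge_2_nat)
  have coeff: "coeff (symb w) m = coeff (symb (yhat h ^ p)) m - c * coeff (symb (yhat h)) m"
    by (simp add: w_def symb_simps)
  consider "m > p" | "m = p" | "0 < m" "m < p" | "m = 0" by linarith
  then show "coeff (symb w) m = coeff (monom (h ^ p) p) m"
  proof cases
    case 1
    then show ?thesis
      using coeff p2 coeff_symb_yhat_power(2)[of p m h] coeff_symb_yhat_power(2)[of 1 m h] by simp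
  next
    case 2
    then show ?thesis
      using coeff p2 coeff_symb_yhat_power(1)[of h p] coeff_symb_yhat_power(2)[of 1 m h] by simp
  next
    case 3
    have "pderiv (symb w) = 0" using commutator_w_x by (simp add: symb_simps flip: symb_commutator_x)
    then have "of_nat m * coeff (symb w) m = 0" by (simp add: pderiv_eq_0_iff_coeff)
    moreover have "of_nat m \<noteq> (0 :: 'a poly)" using 3 by (auto simp: of_nat_poly_eq_0_iff dest: dvd_imp_le)
    ultimately show ?thesis using 3 by simp
  next
    case 4
    have "h * coeff (symb w) m = h * (coeff (symb (yhat h ^ p)) 0 - c * coeff (symb (yhat h ^ 1)) 0)"
      using coeff 4 by simp
    also have "\<dots> = h * coeff (symb (yhat h ^ p)) 0 - c * (h * coeff (symb (yhat h ^ 1)) 0)"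
      by (simp add: algebra_simps)
    also have "\<dots> = 0"
      by (simp only: coeff_0_symb_yhat_power delta_power_p) simp
    finally show ?thesis using h_nonzero 4 p2 by simp
  qed
qed

lemma w_eq: "w = of_R (h ^ p) * weyl_y ^ p"
proof -
  have "symb (of_R (h ^ p) * weyl_y ^ p) = symb w"
    using symb_mult_y_power[of "of_R (h ^ p)" p] by (simp add: symb_simps symb_w smult_monom mult.commute)
  then show ?thesis by (simp add: symb_inj)
qed

lemma pderiv_power_p: "pderiv (f ^ p) = (0 :: 'a poly)"
proof -
  have "of_nat p = (0 :: 'a)" using char_p of_nat_CHAR by metis
  then show ?thesis by (simp add: pderiv_power)
qed

lemma commutes_all':
  assumes "commutator u weyl_x = 0" "commutator weyl_y u = 0"
  shows "u * v = v * u"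
  using assms by (intro commutes_all) (simp_all add: commutator_def)

lemma w_central: "w * v = v * w"
proof (rule commutes_all'[OF commutator_w_x])
  have "symb (commutator weyl_y w) = symb 0"
    by (simp add: symb_commutator_y symb_w map_poly_monom pderiv_power_p symb_simps)
  then show "commutator weyl_y w = 0" by (simp only: symb_inj)
qed

lemma x_power_p_central: "weyl_x ^ p * v = v * (weyl_x ^ p :: 'a weyl)"
proof (rule commutes_all')
  show "commutator (weyl_x ^ p) weyl_x = (0 :: 'a weyl)"
    by (simp add: commutator_def power_commutes)
  have "symb (commutator weyl_y (weyl_x ^ p)) = symb (0 :: 'a weyl)"
    by (simp add: symb_commutator_y weyl_x_of_R symb_simps map_poly_pCons pderiv_power_p flip: of_R_power)
  then show "commutator weyl_y (weyl_x ^ p) = (0 :: 'a weyl)" by (simp only: symb_inj)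
qed

lemma symb_w_power: "symb (w ^ m) = monom (h ^ (p * m)) (p * m)"
proof (induction m)
  case (Suc m)
  have "w ^ Suc m = of_R (h ^ p) * (weyl_y ^ p * w ^ m)"
    by (simp add: w_eq mult.assoc)
  also have "weyl_y ^ p * w ^ m = w ^ m * weyl_y ^ p"
    by (metis power_commuting_commutes w_central)
  finally show ?case
    using Suc by (simp add: symb_simps symb_mult_y_power mult_monom smult_monom power_add)
qed (simp add: symb_simps)

lemma w_power_in_Ah: "w ^ m \<in> Ah h"
  by (rule power_in_Ah[OF w_in_Ah])

section \<open>Derivations that annihilate \<open>x\<close>\<close>

lemma derivation_yhat_centralizes_x:
  assumes d: "derivation_on (Ah h) d" and x: "d weyl_x = 0"
  shows "commutator (d (yhat h)) weyl_x = 0"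
proof -
  note A = subalgebraD[OF subalgebra_Ah[of h]] and g = Ah_generators[of h]
  have "d (yhat h * weyl_x - weyl_x * yhat h) = d (of_R (\<delta> h [:0, 1:]))"
    by (simp add: yhat_of_R weyl_x_of_R)
  then have "d (yhat h * weyl_x) - d (weyl_x * yhat h) = 0"
    using derivation_diff[OF d] A(4) g derivation_of_R[OF d x] by simp
  then show ?thesis
    using derivation_onD(2)[OF d] g x by (simp add: commutator_def)
qed

text \<open>
  \<open>d(yhat\<^sup>p) = ad(yhat)\<^sup>p\<^sup>-\<^sup>1(d yhat)\<close>, and on the centralizer of \<open>x\<close> the
  commutator with \<open>yhat\<close> is \<open>\<delta>\<close> applied to the coefficients.
\<close>

lemma coeff_derivation_w:
  assumes d: "derivation_on (Ah h) d" and x: "d weyl_x = 0"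
  shows "coeff (symb (d w)) k =
    (\<delta> h ^^ (p - 1)) (coeff (symb (d (yhat h))) k) - c * coeff (symb (d (yhat h))) k"
proof -
  note A = subalgebraD[OF subalgebra_Ah[of h]] and g = Ah_generators[of h]
  have "d w = d (yhat h ^ p) - d (of_R c * yhat h)"
    unfolding w_def by (rule derivation_diff[OF d]) (intro power_in_Ah A(4) of_R_in_Ah g)+
  also have "d (of_R c * yhat h) = of_R c * d (yhat h)"
    using derivation_onD(2)[OF d of_R_in_Ah g(2)] derivation_of_R[OF d x] by simp
  also have "d (yhat h ^ p) = (commutator (yhat h) ^^ (p - 1)) (d (yhat h))"
    by (rule derivation_power_prime[OF d g(2) prime_p of_nat_weyl])
  finally show ?thesis
    by (simp add: symb_simps symb_iterated_commutator_yhat[OF derivation_yhat_centralizes_x[OF d x]]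
        coeff_map_poly)
qed

lemma derivation_w_eq_0_iff:
  assumes d: "derivation_on (Ah h) d" and x: "d weyl_x = 0"
  shows "d w = 0 \<longleftrightarrow> (\<forall>k. coeff (symb (d (yhat h))) k \<in> \<Theta> p h)"
proof -
  have "d w = 0 \<longleftrightarrow> symb (d w) = 0"
    using symb_inj[of "d w" 0] by (simp add: symb_simps)
  then show ?thesis
    by (simp add: poly_eq_iff coeff_derivation_w[OF d x] mem_Theta)
qed

lemma degree_symb_nform:
  "degree (symb (nform h g)) = degree g"
  "lead_coeff (symb (nform h g)) = lead_coeff g * h ^ degree g"
proof -
  have coeff: "coeff (symb (nform h g)) m = (\<Sum>i\<le>degree g. coeff g i * coeff (symb (yhat h ^ i)) m)" for m
    by (simp add: lcomb_def symb_def weyl_act_sum weyl_act_simps weyl_act_of_R coeff_sum)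
  have top: "coeff (symb (nform h g)) (degree g) = lead_coeff g * h ^ degree g"
  proof -
    have "coeff (symb (nform h g)) (degree g) =
        (\<Sum>i\<le>degree g. if i = degree g then lead_coeff g * h ^ degree g else 0)"
      unfolding coeff by (rule sum.cong) (auto simp: coeff_symb_yhat_power)
    then show ?thesis by simp
  qed
  have "degree (symb (nform h g)) \<le> degree g"
    by (rule degree_le) (auto simp: coeff coeff_symb_yhat_power)
  moreover have "degree g \<le> degree (symb (nform h g))"
  proof (cases "g = 0")
    case False
    then show ?thesis using top h_nonzero by (intro le_degree) simp
  qed simp
  ultimately show "degree (symb (nform h g)) = degree g" by simp
  with top show "lead_coeff (symb (nform h g)) = lead_coeff g * h ^ degree g" by simp
qed

text \<open>
  The centralizer of \<open>x\<close> in \<open>A\<^sub>h\<close> is \<open>R[w]\<close>: an element of it has a symbol with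
  derivative \<open>0\<close>, hence of degree \<open>p m\<close> unless it is \<open>0\<close>, and the leading
  coefficient is divisible by \<open>h\<^sup>p\<^sup>m\<close>, so that a multiple of \<open>w\<^sup>m\<close> cancels it.
\<close>

lemma derivation_vanishes_on_centralizer_x:
  assumes d: "derivation_on (Ah h) d" and x: "d weyl_x = 0" and dw: "d w = 0"
    and "z \<in> Ah h" "commutator z weyl_x = 0"
  shows "d z = 0"
  using assms(4,5)
proof (induction "degree (symb z)" arbitrary: z rule: less_induct)
  case less
  note A = subalgebraD[OF subalgebra_Ah[of h]]
  obtain g where g: "z = nform h g" using nform_surj[OF less.prems(1)] by blast
  let ?n = "degree (symb z)" and ?a = "of_R (lead_coeff g)"
  show ?case
  proof (cases "?n = 0")
    case True
    then obtain f where "symb z = [:f:]" by (rule degree_eq_zeroE)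
    then have "z = of_R f" by (metis symb_simps(6) symb_inj)
    then show ?thesis using derivation_of_R[OF d x] by simp
  next
    case False
    have lead: "coeff (symb z) ?n = lead_coeff g * h ^ ?n" and deg: "?n = degree g"
      using degree_symb_nform[of g] by (simp_all add: g)
    have "pderiv (symb z) = 0"
      using less.prems(2) by (simp add: symb_simps flip: symb_commutator_x)
    then have "of_nat ?n * coeff (symb z) ?n = 0" by (simp only: pderiv_eq_0_iff_coeff)
    moreover have "coeff (symb z) ?n \<noteq> 0" using False by auto
    ultimately have "p dvd ?n" by (simp add: of_nat_poly_eq_0_iff)
    then obtain m where m: "?n = p * m" by auto
    define v where "v = ?a * w ^ m"
    have v: "symb v = monom (coeff (symb z) ?n) ?n"
      by (simp add: v_def symb_simps symb_w_power smult_monom lead flip: m)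
    have "degree (symb (z - v)) < ?n"
    proof -
      have "degree (symb (z - v)) \<le> ?n"
        by (rule degree_le) (auto simp: symb_simps v coeff_eq_0)
      moreover have "coeff (symb (z - v)) ?n = 0" by (simp add: symb_simps v)
      ultimately show ?thesis using False by (metis le_neq_implies_less leading_coeff_0_iff degree_0)
    qed
    moreover have vA: "v \<in> Ah h" unfolding v_def by (intro A(4) of_R_in_Ah w_power_in_Ah)
    then have "z - v \<in> Ah h" by (rule subalgebra_diff[OF subalgebra_Ah less.prems(1)])
    moreover have "commutator (z - v) weyl_x = 0"
    proof -
      have "symb (commutator v weyl_x) = symb 0"
        by (simp add: symb_commutator_x v pderiv_monom symb_simps of_nat_poly_eq_0_iff \<open>p dvd ?n\<close>)
      then have "commutator v weyl_x = 0" by (simp only: symb_inj)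
      then show ?thesis using less.prems(2) by (simp add: commutator_def algebra_simps)
    qed
    ultimately have "d (z - v) = 0" by (rule less.hyps)
    moreover have "d v = 0"
    proof -
      have "d (w ^ m) = 0"
        by (simp add: derivation_power[OF d w_in_Ah] dw)
      then show ?thesis
        unfolding v_def using derivation_onD(2)[OF d of_R_in_Ah w_power_in_Ah] derivation_of_R[OF d x]
        by simp
    qed
    ultimately show ?thesis using derivation_diff[OF d less.prems(1) vA] by simp
  qed
qed

text \<open>
  The derivation of \<open>A\<^sub>1\<close> with \<open>x \<mapsto> 0\<close> and \<open>y \<mapsto> e\<close> sends \<open>yhat\<close> to \<open>h e\<close>.
  Its value at \<open>w = h\<^sup>p y\<^sup>p\<close> can be computed in terms of \<open>yhat\<close>, which
  gives \<open>\<delta>^(p - 1)(h e) - c h e = 0\<close>, and in terms of \<open>y\<close>, which gives \<open>h\<^sup>p\<close> times the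
  \<open>(p - 1)\<close>-st derivative of \<open>e\<close>.
\<close>

lemma h_mult_in_ThetaD:
  assumes "h * e \<in> \<Theta> p h"
  shows "(pderiv ^^ (p - 1)) e = 0"
proof -
  obtain D where D: "D \<in> Der (Ah (1 :: 'a poly))" "D weyl_x = 0" "D weyl_y = of_R e"
    using D_der_ex[of "1 :: 'a poly" e] by (auto simp: yhat_1)
  have d1: "derivation_on (Ah 1) D" using D(1) by (rule derivation_on_Der)
  then have d: "derivation_on (Ah h) D" by (simp add: derivation_on_def Ah_1)
  have DR: "D (of_R f) = 0" for f by (rule derivation_of_R[OF d D(2)])
  have "D (yhat h) = of_R (h * e)"
    unfolding yhat_def using derivation_onD(2)[OF d1, of weyl_y "of_R h"]
    by (simp add: Ah_1 DR D(3) of_R_mult of_R_commute)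
  moreover have "0 \<in> \<Theta> p h" by (simp add: mem_Theta)
  ultimately have "D w = 0"
    using assms by (simp add: derivation_w_eq_0_iff[OF d D(2)] symb_simps coeff_pCons split: nat.split)
  moreover have "D w = of_R (h ^ p) * D (weyl_y ^ p)"
    unfolding w_eq using derivation_onD(2)[OF d1, of "of_R (h ^ p)" "weyl_y ^ p"]
    by (simp add: Ah_1 DR)
  moreover have "D (weyl_y ^ p) = of_R ((pderiv ^^ (p - 1)) e)"
    using derivation_power_prime[OF d1 _ prime_p of_nat_weyl, of weyl_y]
    by (simp add: Ah_1 D(3) iterated_commutator_y_of_R)
  ultimately have "of_R (h ^ p * (pderiv ^^ (p - 1)) e) = of_R 0" by (simp add: of_R_mult)
  then show ?thesis using h_nonzero by (simp add: of_R_inj del: of_R_0)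
qed

lemma coefficientwise_antiderivative:
  fixes q :: "'a poly poly"
  assumes "\<And>k. (pderiv ^^ (p - 1)) (coeff q k) = 0" and q: "pderiv q = 0"
  obtains G where "map_poly pderiv G = q" "pderiv G = 0"
proof -
  define F where "F = (\<lambda>r :: 'a poly. SOME f. pderiv f = r)"
  have F: "pderiv (F (coeff q k)) = coeff q k" for k
  proof -
    have "\<exists>f. pderiv f = coeff q k"
      using antiderivative_exists[OF prime_p char_p assms(1)] by metis
    then show ?thesis unfolding F_def by (rule someI_ex)
  qed
  \<comment> \<open>Taking \<open>0\<close> as the antiderivative of \<open>0\<close> keeps \<open>G\<close> a polynomial in \<open>t\<^sup>p\<close>.\<close>
  define G where "G = map_poly (\<lambda>r. if r = 0 then 0 else F r) q"
  have G: "coeff G k = (if coeff q k = 0 then 0 else F (coeff q k))" for k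
    by (simp add: G_def coeff_map_poly)
  have "map_poly pderiv G = q"
    by (rule poly_eqI) (simp add: coeff_map_poly G F)
  moreover have "pderiv G = 0"
    using q by (auto simp: pderiv_eq_0_iff_coeff G)
  ultimately show thesis by (rule that)
qed

section \<open>The kernel of the restriction map\<close>

text \<open>
  The centre of \<open>A\<^sub>h\<close> lies in that of \<open>A\<^sub>1\<close>: from \<open>0 = [yhat, z] = h [y, z]\<close> it follows that
  \<open>[y, z] = 0\<close>, as left multiplication by \<open>h\<close> is injective. This is why inner derivations
  vanish on the centre even when they come from elements outside \<open>A\<^sub>h\<close>.
\<close>

lemma center_Ah_central:
  assumes "z \<in> center (Ah h)"
  shows "commutator z weyl_x = 0" "z * v = v * z"
proof -
  have z: "commutator z weyl_x = 0" "commutator (yhat h) z = 0"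
    using assms Ah_generators[of h] by (simp_all add: center_def commutator_def)
  have "symb (of_R h * commutator weyl_y z) = symb 0"
    using commutator_yhat_centralizer(1)[OF z(1), of h] z(2) by simp
  then have "symb (commutator weyl_y z) = symb 0"
    using h_nonzero by (simp add: symb_simps)
  then show "commutator z weyl_x = 0" "z * v = v * z"
    using z(1) commutes_all' by (simp_all only: symb_inj)
qed

lemma centerI: "z \<in> Ah h \<Longrightarrow> (\<And>v. z * v = v * z) \<Longrightarrow> z \<in> center (Ah h)"
  by (simp add: center_def)

lemma ker_ResI:
  assumes r: "r \<in> \<Theta> p h" and a: "a \<in> normalizer (Ah h)"
  shows "der_add (Ah h) (D_der h r) (ad (Ah h) a) \<in> ker_Res h"
proof -
  note D = D_der[OF h_nonzero, of r]
  have d: "derivation_on (Ah h) (D_der h r)" by (rule derivation_on_Der[OF D(1)])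
  have "0 \<in> \<Theta> p h" by (simp add: mem_Theta)
  then have dw: "D_der h r w = 0"
    using r by (simp add: derivation_w_eq_0_iff[OF d D(2)] D(3) symb_simps coeff_pCons split: nat.split)
  have "der_add (Ah h) (D_der h r) (ad (Ah h) a) z = 0" if "z \<in> center (Ah h)" for z
  proof -
    have "z \<in> Ah h" using that by (simp add: center_def)
    then show ?thesis
      using center_Ah_central[OF that] derivation_vanishes_on_centralizer_x[OF d D(2) dw]
      by (simp add: der_add_def ad_def commutator_def)
  qed
  moreover have "der_add (Ah h) (D_der h r) (ad (Ah h) a) \<in> Der (Ah h)"
    by (rule der_add_in_Der[OF subalgebra_Ah D(1) ad_in_Der[OF subalgebra_Ah a]])
  ultimately show ?thesis by (simp add: ker_Res_def Res_def restrict_def fun_eq_iff)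
qed

text \<open>
  Here the vanishing of \<open>D\<close> at the central element \<open>x\<^sup>p\<close> enters: \<open>D(x\<^sup>p)\<close> is
  \<open>ad\<^sub>x\<^sup>p\<^sup>-\<^sup>1(D x)\<close>, i.e. up to sign the \<open>(p - 1)\<close>-st derivative in \<open>t\<close>.
\<close>

lemma inner_at_x:
  assumes D: "D \<in> ker_Res h"
  obtains a where "commutator a weyl_x = D weyl_x"
proof -
  have DD: "D \<in> Der (Ah h)" and "Res (Ah h) D = (\<lambda>z\<in>center (Ah h). 0)"
    using D by (auto simp: ker_Res_def)
  then have D0: "D z = 0" if "z \<in> center (Ah h)" for z
    using that by (metis Res_def restrict_apply')
  note g = Ah_generators(1)[of h]
  have "D (weyl_x ^ p) = 0"
    by (intro D0 centerI power_in_Ah g x_power_p_central)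
  then have "(commutator weyl_x ^^ (p - 1)) (D weyl_x) = 0"
    by (simp add: derivation_power_prime[OF derivation_on_Der[OF DD] g prime_p of_nat_weyl])
  then have "(pderiv ^^ (p - 1)) (symb (D weyl_x)) = 0"
    using symb_iterated_commutator_x[of "p - 1" "D weyl_x"] by (simp add: symb_simps)
  then obtain f where "pderiv f = symb (D weyl_x)"
    using antiderivative_exists[OF prime_p char_poly] by blast
  then have "symb (commutator (of_symb f) weyl_x) = symb (D weyl_x)"
    by (simp add: symb_commutator_x symb_of_symb)
  then show thesis by (intro that) (simp only: symb_inj)
qed

text \<open>
  In other words \<open>A\<^sub>h \<subseteq> R + h A\<^sub>1\<close>; this holds since \<open>yhat f = (h f) y + (h f)'\<close> for \<open>f\<close> in \<open>R\<close>.
\<close>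

lemma h_dvd_coeff_symb_Ah:
  assumes "u \<in> Ah h" "k \<ge> 1"
  shows "h dvd coeff (symb u) k"
proof -
  have mult: "h dvd coeff (symb (yhat h * v)) k" if "h dvd coeff (symb v) k" "k \<ge> 1" for v k
  proof -
    have "coeff (symb (yhat h * v)) k = pderiv (h * coeff (symb v) k) + h * coeff (symb v) (k - 1)"
      using that(2) by (cases k) (simp_all add: symb_def yhat_def weyl_act_simps weyl_act_of_R coeff_map_poly)
    moreover have "h dvd pderiv (h * coeff (symb v) k)"
      using that(1) by (simp add: pderiv_mult)
    ultimately show ?thesis by simp
  qed
  have pow: "h dvd coeff (symb (yhat h ^ n)) k" for n
  proof (induction n)
    case 0
    show ?case using assms(2) by (simp add: symb_simps)
  next
    case (Suc n)
    then show ?case using mult assms(2) by simp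
  qed
  obtain g where "u = nform h g" using nform_surj[OF assms(1)] by blast
  then have "coeff (symb u) k = (\<Sum>i\<le>degree g. coeff g i * coeff (symb (yhat h ^ i)) k)"
    by (simp add: lcomb_def symb_def weyl_act_sum weyl_act_simps weyl_act_of_R coeff_sum)
  then show ?thesis using pow by (simp add: dvd_sum)
qed

text \<open>
  Write \<open>yhat = h y + h'\<close>. Then \<open>[a, yhat] = [a, h] y + h [a, y] + [a, h']\<close>, in which
  \<open>[a, h] = D(h)\<close> and \<open>[a, h'] = D(h')\<close>, because \<open>D\<close> and \<open>ad\<^sub>a\<close> agree at \<open>x\<close> and hence on \<open>R\<close>.
  Both lie in \<open>A\<^sub>h\<close>, so that \<open>h\<close> divides all coefficients of
  their symbols but the constant one. The factor \<open>y\<close> shifts the one coefficient of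
  \<open>[a, h]\<close> that \<open>h\<close> need not divide to position \<open>1\<close>.
\<close>

lemma h_dvd_coeff_defect:
  assumes D: "D \<in> Der (Ah h)" and a: "commutator a weyl_x = D weyl_x" and k: "k \<ge> 2"
  shows "h dvd coeff (symb (D (yhat h) - commutator a (yhat h))) k"
proof -
  define d where "d = (\<lambda>u. D u - commutator a u)"
  have d: "derivation_on (Ah h) d"
    unfolding d_def by (rule derivation_on_diff_commutator[OF derivation_on_Der[OF D]])
  have "d weyl_x = 0" using a by (simp add: d_def)
  then have "d (of_R f) = 0" for f by (rule derivation_of_R[OF d])
  then have aR: "commutator a (of_R f) = D (of_R f)" for f by (simp add: d_def)
  have "commutator a (yhat h) = commutator a (of_R h) * weyl_y + of_R h * commutator a weyl_y
      + commutator a (of_R (pderiv h))"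
    by (simp add: yhat_def weyl_y_of_R commutator_def algebra_simps)
  then have "coeff (symb (commutator a (yhat h))) k = coeff (symb (D (of_R h))) (k - 1)
      + h * coeff (symb (commutator a weyl_y)) k + coeff (symb (D (of_R (pderiv h)))) k"
    using k by (simp add: aR symb_simps symb_mult_y coeff_pCons split: nat.split)
  moreover have "h dvd coeff (symb (D u)) j" if "u \<in> Ah h" "j \<ge> 1" for u j
    using that DerD(1)[OF D] h_dvd_coeff_symb_Ah by blast
  ultimately show ?thesis
    using k by (simp add: symb_simps of_R_in_Ah Ah_generators)
qed

text \<open>
  With \<open>d = D - ad\<^sub>a\<close> annihilating \<open>x\<close>, the coefficients of \<open>b = d(yhat)\<close> lie in \<open>\<Theta>\<close>, and all but
  the constant one are divisible by \<open>h\<close>. These are removed by changing \<open>a\<close> by an element of the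
  centralizer of \<open>x\<close>, and the constant one is the element \<open>r\<close> of \<open>\<Theta>\<close>. That the new \<open>a\<close>
  normalizes \<open>A\<^sub>h\<close> comes for free, since \<open>[a, x] = D(x)\<close> and \<open>[a, yhat] = D(yhat) - r\<close>.
\<close>

lemma ker_ResE:
  assumes D: "D \<in> ker_Res h"
  obtains r a where "r \<in> \<Theta> p h" "a \<in> normalizer (Ah h)"
    "D = der_add (Ah h) (D_der h r) (ad (Ah h) a)"
proof -
  have DD: "D \<in> Der (Ah h)" and "Res (Ah h) D = (\<lambda>z\<in>center (Ah h). 0)"
    using D by (auto simp: ker_Res_def)
  then have D0: "D z = 0" if "z \<in> center (Ah h)" for z
    using that by (metis Res_def restrict_apply')
  obtain a where a: "commutator a weyl_x = D weyl_x" using inner_at_x[OF D] by blast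
  define d where "d = (\<lambda>u. D u - commutator a u)"
  have d: "derivation_on (Ah h) d"
    unfolding d_def by (rule derivation_on_diff_commutator[OF derivation_on_Der[OF DD]])
  have dx: "d weyl_x = 0" using a by (simp add: d_def)
  define b where "b = symb (d (yhat h))"
  have "D w = 0" by (intro D0 centerI w_in_Ah w_central)
  moreover have "commutator a w = 0" using w_central[of a] by (simp add: commutator_def)
  ultimately have "d w = 0" by (simp add: d_def)
  then have Theta: "coeff b k \<in> \<Theta> p h" for k
    by (simp add: derivation_w_eq_0_iff[OF d dx] b_def)
  have b': "pderiv b = 0"
    using derivation_yhat_centralizes_x[OF d dx] by (simp add: b_def symb_simps flip: symb_commutator_x)
  have dvd: "h dvd coeff b k" if "k > 0" for k
  proof (cases "k = 1")
    case True
    from b' have "of_nat 1 * coeff b 1 = 0" by (simp only: pderiv_eq_0_iff_coeff)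
    then show ?thesis by (simp add: True)
  next
    case False
    with that show ?thesis using h_dvd_coeff_defect[OF DD a, of k] by (simp add: b_def d_def)
  qed
  \<comment> \<open>\<open>b = b\<^sub>0 + h q\<close> with \<open>b\<^sub>0\<close> in \<open>R\<close>; the part \<open>h q\<close> is \<open>[yhat, a']\<close> for a coefficientwise
    antiderivative \<open>a'\<close> of \<open>q\<close>.\<close>
  define q where "q = map_poly (\<lambda>r. r div h) (b - [:coeff b 0:])"
  have q: "h * coeff q k = (if k = 0 then 0 else coeff b k)" for k
    using dvd[of k] by (cases k) (simp_all add: q_def coeff_map_poly coeff_pCons)
  have "(pderiv ^^ (p - 1)) (coeff q k) = 0" for k
  proof -
    have "0 \<in> \<Theta> p h" by (simp add: mem_Theta)
    then show ?thesis using Theta[of k] by (intro h_mult_in_ThetaD) (simp add: q)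
  qed
  moreover have "pderiv q = 0"
  proof -
    have "h * (of_nat k * coeff q k) = 0" for k
    proof -
      have "h * (of_nat k * coeff q k) = of_nat k * (h * coeff q k)" by (rule mult.left_commute)
      also have "\<dots> = 0" using b' by (simp add: q pderiv_eq_0_iff_coeff)
      finally show ?thesis .
    qed
    then show ?thesis using h_nonzero by (simp add: pderiv_eq_0_iff_coeff)
  qed
  ultimately obtain G where G: "map_poly pderiv G = q" "pderiv G = 0"
    by (rule coefficientwise_antiderivative)
  define a' where "a' = a - of_symb G"
  have "symb (commutator (of_symb G) weyl_x) = symb 0"
    by (simp add: symb_commutator_x symb_of_symb G symb_simps)
  then have Gx: "commutator (of_symb G) weyl_x = 0" by (simp only: symb_inj)
  then have a'x: "commutator a' weyl_x = D weyl_x"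
    using a by (simp add: a'_def commutator_def algebra_simps)
  have "symb (commutator (yhat h) (of_symb G)) = smult h q"
    by (simp add: commutator_yhat_centralizer(1)[OF Gx] symb_simps symb_commutator_y symb_of_symb G)
  also have "\<dots> = b - [:coeff b 0:]"
    by (rule poly_eqI) (simp add: q coeff_pCons split: nat.split)
  also have "\<dots> = symb (d (yhat h) - of_R (coeff b 0))"
    by (simp add: symb_simps b_def)
  finally have "commutator (yhat h) (of_symb G) = d (yhat h) - of_R (coeff b 0)"
    by (simp only: symb_inj)
  then have a'y: "commutator a' (yhat h) = D (yhat h) - of_R (coeff b 0)"
    by (simp add: a'_def d_def commutator_def algebra_simps)
  note A = subalgebraD[OF subalgebra_Ah[of h]] and g = Ah_generators[of h]
  have "commutator a' v \<in> Ah h" if "v \<in> Ah h" for v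
    using that
  proof (induction rule: Ah_induct)
    case x
    then show ?case using DerD(1)[OF DD g(1)] by (simp add: a'x)
  next
    case yhat
    then show ?case
      using DerD(1)[OF DD g(2)] by (simp add: a'y subalgebra_diff[OF subalgebra_Ah] of_R_in_Ah)
  next
    case one
    then show ?case using of_R_in_Ah[of 0 h] by (simp add: commutator_def)
  next
    case (scale c u)
    have "commutator a' (weyl_scale c u) = weyl_scale c (commutator a' u)"
      by (simp add: commutator_def weyl_scale_mult weyl_scale_diff)
    with scale A(2) show ?case by simp
  next
    case (add u v)
    have "commutator a' (u + v) = commutator a' u + commutator a' v"
      by (simp add: commutator_def algebra_simps)
    with add A(3) show ?case by simp
  next
    case (mult u v)
    have "commutator a' (u * v) = commutator a' u * v + u * commutator a' v"
      by (simp add: commutator_def algebra_simps)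
    with mult A(3,4) show ?case by simp
  qed
  then have N: "a' \<in> normalizer (Ah h)" by (simp add: normalizer_def)
  note Dr = D_der[OF h_nonzero, of "coeff b 0"]
  have "D = der_add (Ah h) (D_der h (coeff b 0)) (ad (Ah h) a')"
  proof (rule Der_Ah_eqI[OF DD])
    show "der_add (Ah h) (D_der h (coeff b 0)) (ad (Ah h) a') \<in> Der (Ah h)"
      by (rule der_add_in_Der[OF subalgebra_Ah Dr(1) ad_in_Der[OF subalgebra_Ah N]])
  qed (simp_all add: der_add_def ad_def g Dr a'x a'y)
  with Theta N show thesis by (rule that)
qed

end

theorem proposition6p9:
  fixes h :: "'a::field poly" and p :: nat
  assumes "CHAR('a) = p" and "p > 0" and "h \<noteq> 0"
  shows "ker_Res h =
    {der_add (Ah h) D E | D E. D \<in> D_Theta p h \<and> E \<in> {ad (Ah h) a | a. a \<in> normalizer (Ah h)}}"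
proof -
  interpret weyl_prime_char h p using assms by unfold_locales
  show ?thesis
  proof (intro equalityI subsetI)
    fix D
    assume "D \<in> ker_Res h"
    then obtain r a where "r \<in> \<Theta> p h" "a \<in> normalizer (Ah h)"
      "D = der_add (Ah h) (D_der h r) (ad (Ah h) a)"
      by (rule ker_ResE)
    then show "D \<in> {der_add (Ah h) D E | D E. D \<in> D_Theta p h \<and> E \<in> {ad (Ah h) a | a. a \<in> normalizer (Ah h)}}"
      unfolding D_Theta_def by blast
  qed (auto simp: D_Theta_def intro: ker_ResI)
qed

end
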